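(* Let $\mathcal{O}$ be the local ring of a reduced algebroid plane curve $Q=\langle f\rangle$, $f=\prod_{i\in I}f_i\in\mathbb{K}[[X,Y]]$, over an algebraically closed field $\mathbb{K}$ of characteristic zero, let $\Omega$ be its module of Kähler differentials, and let $\sigma=(\sigma_1,\ldots,\sigma_r)$ be the conductor of $\Gamma=v(\mathcal{O})$. Let $G$ be a Standard Basis for $\mathcal{O}$ with $\{f_i: i\in I\}\subseteq G$ (classes in $\mathcal{O}$). Consider the following procedure with input $G$. Put $H_0=\{dg: g\in G\}$. For $j=0,1,2,\ldots$, given $H_j$: 1. let $\mathcal{S}$ be the set (up to multiplication by elements of $\mathbb{K}\setminus\{0\}$) of all $\omega$ such that, for some $k\in I$, $\omega$ is an $S_k$-process of $H_j$ over $G$ and $\nu_i(\omega)<\sigma_i$ for some $i\in I$; 2. for each $\omega\in\mathcal{S}$ compute a final reduction of $\omega$ modulo $(H_j,G)$, and let $\mathcal{R}$ be the set of the nonzero final reductions so obtained; 3. put $H_{j+1}=H_j\cup\mathcal{R}$; if $H_{j+1}=H_j$, stop and output $H=H_{j+1}$. Then the procedure always stops after finitely many iterations, and its output $H$ is a Standard Basis for $\Omega$.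
   Context: Setting. $\mathbb{K}$ is an algebraically closed field of characteristic zero, $f=\prod_{i\in I}f_i\in\mathbb{K}[[X,Y]]$, $I=\{1,\ldots,r\}$, with the $f_i$ irreducible and $\langle f_i\rangle\ne\langle f_j\rangle$ for $i\neq j$; $\mathcal{O}=\mathbb{K}[[X,Y]]/\langle f\rangle$ with maximal ideal $\mathcal{M}$, $\mathcal{O}_i=\mathbb{K}[[X,Y]]/\langle f_i\rangle$, and $x,y$ are the classes of $X,Y$. The integral closure of $\mathcal{O}_i$ in its fraction field $\mathcal{Q}_i$ is a discrete valuation ring $\overline{\mathcal{O}_i}=\mathbb{K}[[t_i]]$; the images of $X,Y$ in it give the parameterization $\varphi_i(t_i)=(x(t_i),y(t_i))$ of the branch $\langle f_i\rangle$. The total ring of fractions of $\mathcal{O}$ is $\mathcal{Q}=\bigoplus_{i\in I}\mathbb{K}((t_i))$, the integral closure of $\mathcal{O}$ in it is $\overline{\mathcal{O}}=\bigoplus_{i\in I}\mathbb{K}[[t_i]]$, and $\mathcal{O}\hookrightarrow\overline{\mathcal{O}}$ by $g\mapsto(g(\varphi_1(t_1)),\ldots,g(\varphi_r(t_r)))$. For $h=(h_1,\ldots,h_r)\in\mathcal{Q}$ put $v_i(h)=\operatorname{ord}_{t_i}(h_i)\in\mathbb{Z}\cup\{\infty\}$ ($v_i(h)=\infty$ if $h_i=0$), $v(h)=(v_1(h),\ldots,v_r(h))$. The conductor $\sigma$ is defined by $(\mathcal{O}:\overline{\mathcal{O}})=(t_1^{\sigma_1},\ldots,t_r^{\sigma_r})\overline{\mathcal{O}}$.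 Limits in $\mathcal{Q}$ are taken in the product of the $t_i$-adic topologies. Differentials. $\Omega=(\mathcal{O}dx+\mathcal{O}dy)/(f_xdx+f_ydy)\mathcal{O}$ (quotient of the free module on $dx,dy$), and $dh=h_xdx+h_ydy\in\Omega$ for $h\in\mathcal{O}$. The $\mathcal{O}$-module homomorphism $\varphi^*:\Omega\to\overline{\mathcal{O}}$ sends $\omega=p\,dx+q\,dy$ to the tuple with $i$-th component $t_i\cdot\big(p(\varphi_i(t_i))x'(t_i)+q(\varphi_i(t_i))y'(t_i)\big)$. Its image $\varphi^*(\Omega)$ is a fractional ideal of $\mathcal{O}$ (finitely generated $\mathcal{O}$-submodule of $\mathcal{Q}$ containing a non zero divisor). Put $\nu_i(\omega)=v_i(\varphi^*(\omega))$ and $\nu(\omega)=(\nu_1(\omega),\ldots,\nu_r(\omega))$. Differentials are identified with their images under $\varphi^*$: a Standard Basis for $\Omega$ means a Standard Basis for $\varphi^*(\Omega)$, and reductions, final reductions, $S_k$-processes and "nonzero" for differentials refer to the images in $\varphi^*(\Omega)$. Reductions. Let $G\subset\mathcal{M}\setminus\{0\}$ be finite and $H\subset\mathcal{Q}\setminus\{0\}$. A $G$-product is an element $G^{\alpha}=\prod_{g_i\in G}g_i^{\alpha_i}$ with $\alpha_i\in\mathbb{N}=\{0,1,2,\ldots\}$. For nonzero $u\in\mathcal{Q}$ and $k\in I_u:=\{i\in I: v_i(u)\neq\infty\}$, an element $u'$ is a $k$-reduction of $u$ modulo $(H,G)$ if there are $c\in\mathbb{K}$, $h\in H$ and a $G$-product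 $G^\alpha$ with $u'=u-cG^\alpha h$, $v_i(u')\ge v_i(u)$ for all $i\in I$ and $v_k(u')>v_k(u)$. A reduction of $u$ modulo $(H,G)$ is a $k$-reduction for some $k\in I_u$. An element $u'$ is a final reduction of a nonzero $u\in\mathcal{Q}$ modulo $(H,G)$ if $u'$ is obtained from $u$ by a (possibly infinite) sequence of reductions modulo $(H,G)$, $u_0=u$, $u_j$ a reduction of $u_{j-1}$ (in the infinite case $u'$ is the limit of the $u_j$), and $u'$ admits no reduction modulo $(H,G)$ (the element $0$ admits none). Infinite sequences of reductions are regarded as a single computation. A Standard Basis for $\mathcal{O}$ is a finite set $G\subset\mathcal{M}\setminus\{0\}$ such that every nonzero element of $\mathcal{O}$ admits a reduction modulo $(\{1\},G)$. With $G$ fixed, a Standard Basis for a fractional ideal $\mathcal{I}$ is a finite set $H\subset\mathcal{I}\setminus\{0\}$ such that every nonzero element of $\mathcal{I}$ admits a reduction modulo $(H,G)$. $S_k$-processes. For $k\in I$, an $S_k$-process of $H$ over $G$ is an element $c_1G^{\alpha_1}h_1+c_2G^{\alpha_2}h_2$ with $c_1,c_2\in\mathbb{K}$, $h_1,h_2\in H$ and $G$-products $G^{\alpha_1},G^{\alpha_2}$ such that $v_k(c_1G^{\alpha_1}h_1+c_2G^{\alpha_2}h_2)>\min\{v_k(G^{\alpha_1}h_1),v_k(G^{\alpha_2}h_2)\}$. *)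

theory Defs
  imports
    "HOL-Analysis.Finite_Cartesian_Product"
    "HOL-Computational_Algebra.Formal_Laurent_Series"
    "HOL-Library.Extended"
begin

text \<open>
  Power series in \<open>X, Y\<close> are elements of \<^typ>\<open>'a fps fps\<close>, read as \<open>K[[X]][[Y]]\<close>:
  \<open>fps_nth (fps_nth p j) i\<close> is the coefficient of \<open>X\<^sup>i Y\<^sup>j\<close>. The branches are indexed by a
  finite type \<open>'i\<close>, and \<^typ>\<open>'a fls ^ 'i\<close>, with its componentwise ring structure, is the
  total ring of fractions \<open>Q\<close>. Its library topology is the product of the \<open>t\<close>-adic ones.
\<close>

definition deriv_X :: "'a::comm_ring_1 fps fps \<Rightarrow> 'a fps fps" where
  "deriv_X p = Abs_fps (\<lambda>j. fps_deriv (fps_nth p j))"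

definition deriv_Y :: "'a::comm_ring_1 fps fps \<Rightarrow> 'a fps fps" where
  "deriv_Y p = fps_deriv p"

text \<open>
  The substitution \<open>p(x(t), y(t))\<close>, meaningful when \<open>x\<close> and \<open>y\<close> have no constant term: then
  the summands with \<open>j > n\<close> do not contribute to the coefficient of \<open>t\<^sup>n\<close>.
\<close>

definition subst2 :: "'a::comm_ring_1 fps fps \<Rightarrow> 'a fps \<times> 'a fps \<Rightarrow> 'a fps" where
  "subst2 p = (\<lambda>(x, y).
     Abs_fps (\<lambda>n. fps_nth (\<Sum>j\<le>n. fps_compose (fps_nth p j) x * y ^ j) n))"


subsection \<open>Branches and their parameterizations\<close>

definition frac_field_of :: "'b::field set \<Rightarrow> 'b set" where
  "frac_field_of A = {a / b | a b. a \<in> A \<and> b \<in> A \<and> b \<noteq> 0}"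

definition integral_over :: "'b::field set \<Rightarrow> 'b \<Rightarrow> bool" where
  "integral_over A z \<longleftrightarrow>
     (\<exists>P. lead_coeff P = 1 \<and> (\<forall>n. coeff P n \<in> A) \<and> poly P z = 0)"

text \<open>
  \<open>(x(t), y(t))\<close> parameterizes the branch \<open>\<langle>g\<rangle>\<close> if substitution identifies \<open>K[[X,Y]]/\<langle>g\<rangle>\<close> with
  a subring of \<open>K((t))\<close> whose integral closure in its fraction field is \<open>K[[t]]\<close>.
\<close>

definition parameterization :: "'a::field fps fps \<Rightarrow> 'a fps \<times> 'a fps \<Rightarrow> bool" where
  "parameterization g \<phi> \<longleftrightarrow>
     fps_nth (fst \<phi>) 0 = 0 \<and> fps_nth (snd \<phi>) 0 = 0 \<and>
     (\<forall>p. subst2 p \<phi> = 0 \<longleftrightarrow> g dvd p) \<and>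
     (let A = range (\<lambda>p. fps_to_fls (subst2 p \<phi>))
      in {z \<in> frac_field_of A. integral_over A z} = range fps_to_fls)"


subsection \<open>The local ring and its module of differentials\<close>

definition ring_rel :: "'a::comm_ring_1 fps fps \<Rightarrow> ('a fps fps \<times> 'a fps fps) set" where
  "ring_rel F = {(p, q). F dvd p - q}"

definition cls :: "'a::comm_ring_1 fps fps \<Rightarrow> 'a fps fps \<Rightarrow> 'a fps fps set" where
  "cls F p = ring_rel F `` {p}"

definition local_ring :: "'a::comm_ring_1 fps fps \<Rightarrow> 'a fps fps set set" where
  "local_ring F = UNIV // ring_rel F"

definition max_ideal :: "'a::comm_ring_1 fps fps \<Rightarrow> 'a fps fps set set" where
  "max_ideal F = {cls F p | p. fps_nth (fps_nth p 0) 0 = 0}"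

text \<open>
  The pair \<open>(p, q)\<close> stands for \<open>p dX + q dY\<close>. The module \<open>(O dx + O dy)/(F\<^sub>x dx + F\<^sub>y dy)O\<close> is
  taken as a quotient of \<open>K[[X,Y]]\<^sup>2\<close>, so both \<open>F dX\<close>, \<open>F dY\<close> and \<open>F\<^sub>X dX + F\<^sub>Y dY\<close> are
  factored out.
\<close>

definition omega_rel ::
  "'a::comm_ring_1 fps fps \<Rightarrow> (('a fps fps \<times> 'a fps fps) \<times> ('a fps fps \<times> 'a fps fps)) set" where
  "omega_rel F = {((p, q), (p', q')).
     \<exists>a b c. p - p' = a * deriv_X F + b * F \<and> q - q' = a * deriv_Y F + c * F}"

definition Omega :: "'a::comm_ring_1 fps fps \<Rightarrow> ('a fps fps \<times> 'a fps fps) set set" where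
  "Omega F = UNIV // omega_rel F"

definition differential ::
  "'a::comm_ring_1 fps fps \<Rightarrow> 'a fps fps set \<Rightarrow> ('a fps fps \<times> 'a fps fps) set" where
  "differential F g = (\<Union>p\<in>g. omega_rel F `` {(deriv_X p, deriv_Y p)})"

text \<open>
  The next two maps are defined on classes. They are given by the value common to all
  representatives.
\<close>

definition emb :: "('i::finite \<Rightarrow> 'a::field fps \<times> 'a fps) \<Rightarrow> 'a fps fps set \<Rightarrow> 'a fls ^ 'i" where
  "emb \<phi> g = the_elem ((\<lambda>p. \<chi> i. fps_to_fls (subst2 p (\<phi> i))) ` g)"

definition phi_star ::
  "('i::finite \<Rightarrow> 'a::field fps \<times> 'a fps) \<Rightarrow> ('a fps fps \<times> 'a fps fps) set \<Rightarrow> 'a fls ^ 'i" where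
  "phi_star \<phi> w = the_elem ((\<lambda>(p, q). \<chi> i. fps_to_fls (fps_X *
     (subst2 p (\<phi> i) * fps_deriv (fst (\<phi> i)) + subst2 q (\<phi> i) * fps_deriv (snd (\<phi> i))))) ` w)"

definition O_bar :: "('a::field fls ^ 'i::finite) set" where
  "O_bar = {h. \<forall>i. h $ i \<in> range fps_to_fls}"

definition conductor ::
  "'a::field fps fps \<Rightarrow> ('i::finite \<Rightarrow> 'a fps \<times> 'a fps) \<Rightarrow> ('i \<Rightarrow> nat) \<Rightarrow> bool" where
  "conductor F \<phi> \<sigma> \<longleftrightarrow>
     {h. \<forall>b\<in>O_bar. h * b \<in> emb \<phi> ` local_ring F} = {(\<chi> i. fls_X ^ \<sigma> i) * b | b. b \<in> O_bar}"


subsection \<open>Values, reductions and standard bases\<close>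

definition val :: "'i::finite \<Rightarrow> 'a::field fls ^ 'i \<Rightarrow> int extended" where
  "val i h = (if h $ i = 0 then Pinf else Fin (fls_subdegree (h $ i)))"

definition G_product ::
  "('a::field fls ^ 'i::finite) set \<Rightarrow> ('a fls ^ 'i \<Rightarrow> nat) \<Rightarrow> 'a fls ^ 'i" where
  "G_product G \<alpha> = (\<Prod>g\<in>G. g ^ \<alpha> g)"

text \<open>Sets of generators are passed in the order \<open>(H, G)\<close>, and \<open>G\<close> is a subset of \<open>Q\<close> here.\<close>

definition k_reduction ::
  "('a::field fls ^ 'i::finite) set \<Rightarrow> ('a fls ^ 'i) set \<Rightarrow> 'i \<Rightarrow> 'a fls ^ 'i \<Rightarrow> 'a fls ^ 'i \<Rightarrow> bool"
where
  "k_reduction H G k u u' \<longleftrightarrow>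
     val k u \<noteq> Pinf \<and>
     (\<exists>c \<alpha>. \<exists>h\<in>H. u' = u - fls_const c *s (G_product G \<alpha> * h)) \<and>
     (\<forall>i. val i u' \<ge> val i u) \<and> val k u' > val k u"

definition reduction ::
  "('a::field fls ^ 'i::finite) set \<Rightarrow> ('a fls ^ 'i) set \<Rightarrow> 'a fls ^ 'i \<Rightarrow> 'a fls ^ 'i \<Rightarrow> bool" where
  "reduction H G u u' \<longleftrightarrow> (\<exists>k. k_reduction H G k u u')"

definition final_reduction ::
  "('a::field fls ^ 'i::finite) set \<Rightarrow> ('a fls ^ 'i) set \<Rightarrow> 'a fls ^ 'i \<Rightarrow> 'a fls ^ 'i \<Rightarrow> bool" where
  "final_reduction H G u u' \<longleftrightarrow>
     u \<noteq> 0 \<and>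
     ((reduction H G)\<^sup>*\<^sup>* u u' \<or>
      (\<exists>U. U 0 = u \<and> (\<forall>j::nat. reduction H G (U j) (U (Suc j))) \<and> U \<longlonglongrightarrow> u')) \<and>
     (\<nexists>u''. reduction H G u' u'')"

definition standard_basis ::
  "('a::field fls ^ 'i::finite) set \<Rightarrow> ('a fls ^ 'i) set \<Rightarrow> ('a fls ^ 'i) set \<Rightarrow> bool" where
  "standard_basis H G J \<longleftrightarrow>
     finite H \<and> H \<subseteq> J - {0} \<and> (\<forall>u\<in>J. u \<noteq> 0 \<longrightarrow> (\<exists>u'. reduction H G u u'))"

definition ring_standard_basis ::
  "'a::field fps fps \<Rightarrow> ('i::finite \<Rightarrow> 'a fps \<times> 'a fps) \<Rightarrow> 'a fps fps set set \<Rightarrow> bool" where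
  "ring_standard_basis F \<phi> G \<longleftrightarrow>
     finite G \<and> G \<subseteq> max_ideal F - {cls F 0} \<and>
     (\<forall>u \<in> emb \<phi> ` local_ring F. u \<noteq> 0 \<longrightarrow> (\<exists>u'. reduction {1} (emb \<phi> ` G) u u'))"


subsection \<open>The procedure\<close>

definition S_process ::
  "('a::field fls ^ 'i::finite) set \<Rightarrow> ('a fls ^ 'i) set \<Rightarrow> 'i \<Rightarrow> 'a fls ^ 'i \<Rightarrow> bool" where
  "S_process H G k \<omega> \<longleftrightarrow>
     (\<exists>c1 c2 \<alpha>1 \<alpha>2. \<exists>h1\<in>H. \<exists>h2\<in>H.
        \<omega> = fls_const c1 *s (G_product G \<alpha>1 * h1) + fls_const c2 *s (G_product G \<alpha>2 * h2) \<and>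
        val k \<omega> > min (val k (G_product G \<alpha>1 * h1)) (val k (G_product G \<alpha>2 * h2)))"

definition relevant_S_processes ::
  "('a::field fls ^ 'i::finite) set \<Rightarrow> ('a fls ^ 'i) set \<Rightarrow> ('i \<Rightarrow> nat) \<Rightarrow> ('a fls ^ 'i) set" where
  "relevant_S_processes H G \<sigma> =
     {\<omega>. (\<exists>k. S_process H G k \<omega>) \<and> (\<exists>i. val i \<omega> < Fin (int (\<sigma> i)))}"

definition scalar_representatives ::
  "('a::field fls ^ 'i::finite) set \<Rightarrow> ('a fls ^ 'i) set \<Rightarrow> bool" where
  "scalar_representatives A S \<longleftrightarrow>
     S \<subseteq> A \<and> (\<forall>\<omega>\<in>A. \<exists>!\<omega>'. \<omega>' \<in> S \<and> (\<exists>c. c \<noteq> 0 \<and> \<omega> = fls_const c *s \<omega>'))"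

text \<open>
  One iteration, turning \<open>H\<close> into \<open>H'\<close>. It is a relation because final reductions are not
  unique: \<open>\<rho>\<close> records the one computed for each element of \<open>S\<close>.
\<close>

definition iteration ::
  "('a::field fls ^ 'i::finite) set \<Rightarrow> ('i \<Rightarrow> nat) \<Rightarrow> ('a fls ^ 'i) set \<Rightarrow> ('a fls ^ 'i) set \<Rightarrow> bool"
where
  "iteration G \<sigma> H H' \<longleftrightarrow>
     (\<exists>S \<rho>. scalar_representatives (relevant_S_processes H G \<sigma>) S \<and>
            (\<forall>\<omega>\<in>S. final_reduction H G \<omega> (\<rho> \<omega>)) \<and>
            H' = H \<union> {\<rho> \<omega> | \<omega>. \<omega> \<in> S \<and> \<rho> \<omega> \<noteq> 0})"

definition initial_set ::
  "'a::field fps fps \<Rightarrow> ('i::finite \<Rightarrow> 'a fps \<times> 'a fps) \<Rightarrow> 'a fps fps set set \<Rightarrow> ('a fls ^ 'i) set"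
where
  "initial_set F \<phi> G = (\<lambda>g. phi_star \<phi> (differential F g)) ` G"

text \<open>
  \<open>Hs 0, \<dots>, Hs n\<close> are the successive sets of an execution that has made \<open>n\<close> iterations
  without meeting the stopping condition.
\<close>

definition execution ::
  "'a::field fps fps \<Rightarrow> ('i::finite \<Rightarrow> 'a fps \<times> 'a fps) \<Rightarrow> ('i \<Rightarrow> nat) \<Rightarrow> 'a fps fps set set \<Rightarrow>
   nat \<Rightarrow> (nat \<Rightarrow> ('a fls ^ 'i) set) \<Rightarrow> bool" where
  "execution F \<phi> \<sigma> G n Hs \<longleftrightarrow>
     Hs 0 = initial_set F \<phi> G \<and>
     (\<forall>j<n. iteration (emb \<phi> ` G) \<sigma> (Hs j) (Hs (Suc j)) \<and> Hs (Suc j) \<noteq> Hs j)"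

end

theory Submission
  imports Defs
begin

text \<open>
  Call \<open>G\<^sup>\<alpha> h\<close> with \<open>h \<in> H\<close> a multiple. An element \<open>u\<close> is reducible iff some multiple has value at
  least \<open>v(u)\<close> at every branch, with equality at a branch where \<open>u\<close> does not vanish. Only finitely
  many multiples have a given value at a given branch. This bounds the relevant \<open>S\<close>-processes and
  makes sequences of reductions converge.

  The standard basis property of \<open>G\<close>, applied to the conductor, yields for all \<open>k\<close> and
  \<open>n \<ge> max(\<sigma>\<^sub>k, 1)\<close> a \<open>G\<close>-product with value \<open>n\<close> at \<open>k\<close> that vanishes at the other branches.
  Exchanging one of its factors \<open>g\<close> for \<open>dg\<close> keeps all values, because \<open>t d/dt\<close> preserves positive
  orders in characteristic zero. So an irreducible differential has each value infinite or below
  \<open>max(\<sigma>\<^sub>k, 1)\<close>, every new element of the procedure has a new vector of values, and there are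
  finitely many such vectors.

  At a fixpoint all relevant \<open>S\<close>-processes reduce to zero, and the remaining ones, having values in
  the conductor, are combinations of the multiples just described. Starting from an expression of
  \<open>u\<close> by multiples modulo high powers of the \<open>t\<^sub>i\<close>, one replaces cancelling leading terms by
  \<open>S\<close>-processes until the smallest value of the terms at each branch is that of \<open>u\<close>.
\<close>

unbundle no Formal_Power_Series.fps_syntax

subsection \<open>Values\<close>

lemma smult_nth [simp]: "fls_nth ((fls_const c *s u) $ i) n = c * fls_nth (u $ i) n"
  for u :: "'a::field fls ^ 'i::finite"
  by (simp add: fls_mult_const_nth)

lemma Fin_le_val_iff: "Fin n \<le> val i u \<longleftrightarrow> (\<forall>m<n. fls_nth (u $ i) m = 0)"
proof (cases "u $ i = 0")
  case True
  then show ?thesis by (simp add: val_def)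
next
  case False
  then show ?thesis
    by (auto simp: val_def intro: fls_subdegree_geI)
qed

lemma val_eq_Pinf_iff: "val i u = Pinf \<longleftrightarrow> u $ i = 0"
  by (simp add: val_def)

lemma val_neq_Minf [simp]: "val i u \<noteq> Minf"
  by (simp add: val_def)

lemma val_eq_Fin_iff:
  "val i u = Fin n \<longleftrightarrow> fls_nth (u $ i) n \<noteq> 0 \<and> (\<forall>m<n. fls_nth (u $ i) m = 0)"
  by (auto simp: val_def intro: fls_subdegree_eqI)

lemma val_neq_PinfE:
  assumes "val i u \<noteq> Pinf"
  obtains n where "val i u = Fin n"
  using assms by (cases "val i u") auto

text \<open>Testing every coefficient below \<open>x\<close> also covers \<open>x = Pinf\<close>. In
  this coefficientwise form lower bounds on values pass to sums and scalar multiples at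
  once.\<close>

lemma le_val_iff_nth: "x \<le> val i u \<longleftrightarrow> (\<forall>m. Fin m < x \<longrightarrow> fls_nth (u $ i) m = 0)"
proof (cases x)
  case (Fin n)
  then show ?thesis by (simp add: Fin_le_val_iff)
next
  case Pinf
  then show ?thesis by (auto simp: val_eq_Pinf_iff intro: fls_eqI)
qed simp

lemma less_val_iff_nth: "Fin n < val i u \<longleftrightarrow> (\<forall>m\<le>n. fls_nth (u $ i) m = 0)"
proof -
  have "Fin n < val i u \<longleftrightarrow> Fin (n + 1) \<le> val i u"
    by (cases "val i u") auto
  then show ?thesis by (auto simp: Fin_le_val_iff)
qed

lemma le_val_add: "x \<le> val i u \<Longrightarrow> x \<le> val i w \<Longrightarrow> x \<le> val i (u + w)"
  by (simp add: le_val_iff_nth)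

lemma le_val_diff: "x \<le> val i u \<Longrightarrow> x \<le> val i w \<Longrightarrow> x \<le> val i (u - w)"
  by (simp add: le_val_iff_nth)

lemma le_val_smult: "x \<le> val i u \<Longrightarrow> x \<le> val i (fls_const c *s u)"
  unfolding le_val_iff_nth by simp

lemma val_smult: "c \<noteq> 0 \<Longrightarrow> val i (fls_const c *s u) = val i u"
  by (simp add: val_def)

lemma val_mult: "val i (u * w) = val i u + val i w"
  by (simp add: val_def)

lemma val_zero [simp]: "val i 0 = Pinf"
  by (simp add: val_def)

lemma val_one [simp]: "val i 1 = 0"
  by (simp add: val_def zero_extended_def)

lemma le_val_mult: "Fin m \<le> val i u \<Longrightarrow> Fin n \<le> val i w \<Longrightarrow> Fin (m + n) \<le> val i (u * w)"
  using add_mono[of "Fin m" "val i u" "Fin n" "val i w"] by (simp add: val_mult)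

lemma le_val_mult_right: "Fin 0 \<le> val i u \<Longrightarrow> x \<le> val i w \<Longrightarrow> x \<le> val i (u * w)"
  using add_mono[of "0" "val i u" x "val i w"] by (simp add: val_mult flip: zero_extended_def)

lemma val_eq_vec_zero: "(\<And>i. val i u = Pinf) \<Longrightarrow> u = 0"
  by (simp add: val_eq_Pinf_iff vec_eq_iff)

lemma val_cong: "u $ i = w $ i \<Longrightarrow> val i u = val i w"
  by (simp add: val_def)

lemma O_bar_iff: "u \<in> O_bar \<longleftrightarrow> (\<forall>i. Fin 0 \<le> val i u)"
proof -
  have "u $ i \<in> range fps_to_fls \<longleftrightarrow> Fin 0 \<le> val i u" for i
  proof
    assume "u $ i \<in> range fps_to_fls"
    then show "Fin 0 \<le> val i u" by (auto simp: Fin_le_val_iff)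
  next
    assume "Fin 0 \<le> val i u"
    then have "0 \<le> fls_subdegree (u $ i)"
      by (auto simp: val_def split: if_splits)
    then show "u $ i \<in> range fps_to_fls"
      by (metis fls_regpart_to_fls_trivial rangeI)
  qed
  then show ?thesis by (simp add: O_bar_def)
qed

text \<open>Viewing Q as a vector space over K gives access to linear spans, in which the
  approximations by multiples are expressed later.\<close>

interpretation fls_vec: vector_space "\<lambda>c (u :: 'a::field fls ^ 'i::finite). fls_const c *s u"
  by unfold_locales
     (simp_all add: vec_eq_iff algebra_simps flip: fls_plus_const)

section \<open>Convergence in the product of the \<open>t\<close>-adic topologies\<close>

lemma tendsto_vals_ge:
  fixes U :: "nat \<Rightarrow> 'a::field fls ^ 'i::finite"
  assumes "U \<longlonglongrightarrow> w"
  shows "eventually (\<lambda>j. \<forall>i. Fin n \<le> val i (U j - w)) sequentially"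
proof -
  have "eventually (\<lambda>j. Fin n \<le> val i (U j - w)) sequentially" for i
  proof -
    \<comment> \<open>The distance is a power of 2 whose exponent is minus the order of the
      difference. A negative order gives distance above 1, which is why \<open>max\<close> may cap
      the radius at 1.\<close>
    define e :: real where "e = inverse (2 ^ nat (max n 0))"
    have "e > 0" by (simp add: e_def)
    have "(\<lambda>j. U j $ i) \<longlonglongrightarrow> w $ i"
      using assms by (rule tendsto_vec_nth)
    then have "eventually (\<lambda>j. dist (U j $ i) (w $ i) < e) sequentially"
      using \<open>e > 0\<close> by (rule tendstoD)
    then show ?thesis
    proof eventually_elim
      case (elim j)
      let ?d = "fls_subdegree (U j $ i - w $ i)"
      show ?case
      proof (cases "U j $ i = w $ i")
        case True
        then show ?thesis by (simp add: Fin_le_val_iff)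
      next
        case False
        have "?d \<ge> n"
        proof (rule ccontr)
          assume "\<not> ?d \<ge> n"
          then have "nat ?d \<le> nat (max n 0)" by simp
          then have "e \<le> inverse (2 ^ nat ?d)"
            by (simp add: e_def le_imp_inverse_le power_increasing)
          moreover have "e \<le> 1" by (simp add: e_def inverse_le_1_iff)
          moreover have "(1::real) \<le> 2 ^ nat (- ?d)" by simp
          ultimately have "e \<le> dist (U j $ i) (w $ i)"
            using False unfolding dist_fls_def by (smt (verit))
          with elim show False by simp
        qed
        then show ?thesis using False by (simp add: val_def)
      qed
    qed
  qed
  then show ?thesis by (simp add: eventually_all_finite)
qed

lemma tendsto_of_vals_ge:
  fixes U :: "nat \<Rightarrow> 'a::field fls ^ 'i::finite"
  assumes "\<And>n i. eventually (\<lambda>j. Fin (int n) \<le> val i (U j - w)) sequentially"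
  shows "U \<longlonglongrightarrow> w"
proof -
  have "(\<lambda>j. U j $ i) \<longlonglongrightarrow> w $ i" for i
  proof (rule tendstoI)
    fix e :: real assume "e > 0"
    obtain n where n: "inverse (2 ^ n) < e"
      using real_arch_pow_inv[of e "inverse 2"] \<open>e > 0\<close> by (auto simp: power_one_over inverse_eq_divide)
    show "eventually (\<lambda>j. dist (U j $ i) (w $ i) < e) sequentially"
      using assms[of n i]
    proof eventually_elim
      case (elim j)
      show ?case
      proof (cases "U j $ i = w $ i")
        case False
        then have "int n \<le> fls_subdegree (U j $ i - w $ i)"
          using elim by (simp add: val_def)
        moreover from this have "dist (U j $ i) (w $ i) \<le> inverse (2 ^ n)"
          using False by (auto simp: dist_fls_def intro!: le_imp_inverse_le power_increasing)
        ultimately show ?thesis using n by simp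
      qed (use \<open>e > 0\<close> in simp)
    qed
  qed
  then have "(\<lambda>j. \<chi> i. U j $ i) \<longlonglongrightarrow> (\<chi> i. w $ i)" by (rule tendsto_vec_lambda)
  then show ?thesis by simp
qed

text \<open>Completeness. By the ultrametric inequality it suffices that consecutive differences
  tend to zero, and \<open>O_bar\<close> keeps the exponents nonnegative.\<close>

lemma O_bar_convergent:
  fixes U :: "nat \<Rightarrow> 'a::field fls ^ 'i::finite"
  assumes diff: "\<And>n i. eventually (\<lambda>j. Fin (int n) \<le> val i (U (Suc j) - U j)) sequentially"
    and U: "\<And>j. U j \<in> O_bar"
  obtains w where "U \<longlonglongrightarrow> w"
proof -
  have "\<exists>J. \<forall>j\<ge>J. \<forall>i. Fin (int n) \<le> val i (U (Suc j) - U j)" for n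
    using diff by (simp add: eventually_sequentially[symmetric] eventually_all_finite)
  then obtain J where J: "\<And>n j i. j \<ge> J n \<Longrightarrow> Fin (int n) \<le> val i (U (Suc j) - U j)"
    by metis
  have near: "Fin (int n) \<le> val i (U j - U (J n))" if "j \<ge> J n" for n i j
    using that
  proof (induction j rule: dec_induct)
    case base
    then show ?case by simp
  next
    case (step j)
    then have "Fin (int n) \<le> val i ((U j - U (J n)) + (U (Suc j) - U j))"
      using J by (intro le_val_add) auto
    then show ?case by (simp add: algebra_simps)
  qed
  \<comment> \<open>From the index \<open>J (Suc n)\<close> on, changes have value at least
    \<open>n + 1\<close>, so the coefficient of exponent \<open>n\<close> is constant. The limit
    collects these stable coefficients.\<close>
  define w where "w = (\<chi> i. fps_to_fls (Abs_fps (\<lambda>n. fls_nth (U (J (Suc n)) $ i) (int n))))"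
  have "U \<longlonglongrightarrow> w"
  proof (rule tendsto_of_vals_ge)
    fix n i
    have "Fin (int n) \<le> val i (U j - w)" if j: "\<forall>m\<le>n. J m \<le> j" for j
      unfolding Fin_le_val_iff
    proof (intro allI impI)
      fix m :: int assume m: "m < int n"
      show "fls_nth ((U j - w) $ i) m = 0"
      proof (cases "m < 0")
        case True
        then have "fls_nth (U j $ i) m = 0"
          using U[of j] by (auto simp: O_bar_iff Fin_le_val_iff)
        then show ?thesis using True by (simp add: w_def)
      next
        case False
        then obtain m' where m': "m = int m'" by (metis nonneg_int_cases not_less)
        then have "J (Suc m') \<le> j" using j m by simp
        from near[OF this, of i] have "fls_nth (U j $ i) m = fls_nth (U (J (Suc m')) $ i) m"
          by (simp add: Fin_le_val_iff m')
        then show ?thesis by (simp add: w_def m')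
      qed
    qed
    then have "\<forall>j\<ge>Max (J ` {..n}). Fin (int n) \<le> val i (U j - w)"
      by simp
    then show "eventually (\<lambda>j. Fin (int n) \<le> val i (U j - w)) sequentially"
      unfolding eventually_sequentially by (rule exI)
  qed
  then show thesis by (rule that)
qed


subsection \<open>Reductions\<close>

definition multiples ::
  "('a::field fls ^ 'i::finite) set \<Rightarrow> ('a fls ^ 'i) set \<Rightarrow> ('a fls ^ 'i) set" where
  "multiples H G = {G_product G \<alpha> * h | \<alpha> h. h \<in> H}"

lemma multiplesI: "h \<in> H \<Longrightarrow> G_product G \<alpha> * h \<in> multiples H G"
  by (auto simp: multiples_def)

lemma G_product_zero [simp]: "G_product G (\<lambda>_. 0) = 1"
  by (simp add: G_product_def)

lemma subset_multiples: "H \<subseteq> multiples H G"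
  using multiplesI[of _ H G "\<lambda>_. 0"] by auto

lemma multiples_mono: "H \<subseteq> H' \<Longrightarrow> multiples H G \<subseteq> multiples H' G"
  by (auto simp: multiples_def)

text \<open>The scalar is nonzero because the value at \<open>k\<close> grows. To cancel the leading
  coefficient of \<open>u\<close> at \<open>k\<close>, the multiple must have exactly that order
  there. At every branch, \<open>u - u'\<close> has at least the value of \<open>u\<close>.\<close>

lemma k_reductionE:
  assumes "k_reduction H G k u u'"
  obtains c T where "T \<in> multiples H G" "u' = u - fls_const c *s T" "val k u \<noteq> Pinf"
    "val k T = val k u" "\<And>i. val i u \<le> val i T" "\<And>i. val i u \<le> val i u'" "val k u < val k u'"
proof -
  from assms obtain c \<alpha> h where h: "h \<in> H" "u' = u - fls_const c *s (G_product G \<alpha> * h)"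
    and k: "val k u \<noteq> Pinf" "val k u < val k u'" and ge: "\<And>i. val i u \<le> val i u'"
    by (auto simp: k_reduction_def)
  let ?T = "G_product G \<alpha> * h"
  have c: "c \<noteq> 0" using h k by auto
  have ge': "val i u \<le> val i ?T" for i
  proof -
    have "val i u \<le> val i (u - u')" using ge by (intro le_val_diff) auto
    then show ?thesis using h c by (simp add: val_smult)
  qed
  have "val k ?T = val k u"
  proof (rule antisym)
    obtain n where n: "val k u = Fin n" using k(1) by (rule val_neq_PinfE)
    have "fls_nth (u $ k) n \<noteq> 0" using n by (simp add: val_eq_Fin_iff)
    moreover have "fls_nth (u' $ k) n = 0" using k(2) unfolding n less_val_iff_nth by simp
    ultimately have "fls_nth (?T $ k) n \<noteq> 0" using h(2) by auto
    then have "\<not> Fin n < val k ?T" by (auto simp: less_val_iff_nth)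
    then show "val k ?T \<le> val k u" using n by simp
  qed (rule ge')
  then show thesis using h k ge ge' by (intro that[of ?T c]) (auto simp: multiplesI)
qed

lemma k_reduction_exists:
  assumes T: "T \<in> multiples H G" and k: "val k u \<noteq> Pinf" "val k T = val k u"
    and ge: "\<And>i. val i u \<le> val i T"
  obtains u' where "k_reduction H G k u u'"
proof -
  obtain n where n: "val k u = Fin n" using k(1) by (rule val_neq_PinfE)
  define c where "c = fls_nth (u $ k) n / fls_nth (T $ k) n"
  have T0: "fls_nth (T $ k) n \<noteq> 0" using n k(2) by (metis val_eq_Fin_iff)
  let ?u = "u - fls_const c *s T"
  have "val k u < val k ?u"
    unfolding n less_val_iff_nth
  proof (intro allI impI)
    fix m assume "m \<le> n"
    then consider "m < n" | "m = n" by linarith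
    then show "fls_nth (?u $ k) m = 0"
    proof cases
      case 1
      have "val k T = Fin n" using n k(2) by simp
      with 1 n show ?thesis by (simp add: val_eq_Fin_iff)
    qed (use T0 in \<open>simp add: c_def\<close>)
  qed
  moreover have "val i u \<le> val i ?u" for i
    using ge by (intro le_val_diff le_val_smult) auto
  moreover obtain \<alpha> h where "h \<in> H" "T = G_product G \<alpha> * h"
    using T by (auto simp: multiples_def)
  ultimately have "k_reduction H G k u ?u"
    using k(1) unfolding k_reduction_def by blast
  then show thesis by (rule that)
qed

text \<open>Reducibility of \<open>u\<close> thus depends only on its vector of values, which lets a
  count of such vectors decide termination.\<close>

lemma reducible_iff:
  "(\<exists>u'. reduction H G u u') \<longleftrightarrow>
    (\<exists>k. \<exists>T\<in>multiples H G. val k u \<noteq> Pinf \<and> val k T = val k u \<and> (\<forall>i. val i u \<le> val i T))"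
  unfolding reduction_def by (metis k_reductionE k_reduction_exists)

text \<open>A final reduction may be the limit of infinitely many steps, so an invariant has to
  survive limits as well as single steps.\<close>

lemma final_reduction_invariant:
  assumes "final_reduction H G u u'" and "P u"
    and step: "\<And>w w'. P w \<Longrightarrow> reduction H G w w' \<Longrightarrow> P w'"
    and limit: "\<And>U w. (\<And>j. P (U j)) \<Longrightarrow> U \<longlonglongrightarrow> w \<Longrightarrow> P w"
  shows "P u'"
proof -
  from assms(1) consider "(reduction H G)\<^sup>*\<^sup>* u u'"
    | U where "U 0 = u" "\<And>j. reduction H G (U j) (U (Suc j))" "U \<longlonglongrightarrow> u'"
    unfolding final_reduction_def by blast
  then show ?thesis
  proof cases
    case 1
    then show ?thesis by induction (use assms(2) step in auto)
  next
    case 2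
    have "P (U j)" for j by (induction j) (use 2 assms(2) step in auto)
    then show ?thesis using 2(3) by (rule limit)
  qed
qed

text \<open>Positive values at every branch are what membership in the maximal ideal provides. They
  make the value of a \<open>G\<close>-product grow with its total degree.\<close>

locale monomials =
  fixes G :: "('a::field fls ^ 'i::finite) set"
  assumes finite_G: "finite G"
    and val_G: "g \<in> G \<Longrightarrow> Fin 1 \<le> val i g"
begin

lemma val_G_product: "Fin (int (\<Sum>g\<in>G. \<alpha> g)) \<le> val i (G_product G \<alpha>)"
proof -
  have "Fin (int (\<Sum>g\<in>A. \<alpha> g)) \<le> val i (\<Prod>g\<in>A. g ^ \<alpha> g)" if "finite A" "A \<subseteq> G" for A
    using that
  proof (induction A rule: finite_induct)
    case empty
    then show ?case by (simp add: zero_extended_def)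
  next
    case (insert g A)
    have "Fin (int n) \<le> val i (g ^ n)" for n
    proof (induction n)
      case (Suc n)
      from le_val_mult[OF val_G Suc, of g] insert.prems show ?case by simp
    qed (simp add: zero_extended_def)
    from le_val_mult[OF this insert.IH, of "\<alpha> g"] insert show ?case by simp
  qed
  then show ?thesis using finite_G by (simp add: G_product_def)
qed

lemma G_product_in_O_bar: "G_product G \<alpha> \<in> O_bar"
  using val_G_product[of \<alpha>] unfolding O_bar_iff
  by (meson less_eq_extended.simps(1) of_nat_0_le_iff order_trans)

lemma multiples_in_O_bar: "H \<subseteq> O_bar \<Longrightarrow> multiples H G \<subseteq> O_bar"
  using G_product_in_O_bar
  by (fastforce simp: multiples_def O_bar_iff intro: le_val_mult_right)

text \<open>The value at the single branch \<open>k\<close> already bounds the total degree, because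
  each factor from \<open>G\<close> adds at least 1 and \<open>h\<close> has no pole.\<close>

lemma finite_multiples_bounded:
  assumes "finite H" "H \<subseteq> O_bar"
  shows "finite {T \<in> multiples H G. val k T \<le> Fin n}"
proof -
  \<comment> \<open>Exponents outside \<open>G\<close> do not affect the product. Restricting them
    to \<open>G\<close> leaves a finite set of exponent functions.\<close>
  define E where "E = (\<Pi>\<^sub>E g\<in>G. {..nat n})"
  have "{T \<in> multiples H G. val k T \<le> Fin n} \<subseteq> (\<lambda>(\<alpha>, h). G_product G \<alpha> * h) ` (E \<times> H)"
  proof safe
    fix T assume "T \<in> multiples H G" and n: "val k T \<le> Fin n"
    then obtain \<alpha> h where T: "T = G_product G \<alpha> * h" "h \<in> H" by (auto simp: multiples_def)
    have "Fin (int (sum \<alpha> G) + 0) \<le> val k T"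
      unfolding T(1) using assms(2) T(2)
      by (intro le_val_mult val_G_product) (auto simp: O_bar_iff)
    with n have "Fin (int (sum \<alpha> G)) \<le> Fin n" by (simp only: add_0_right order_trans)
    then have "sum \<alpha> G \<le> nat n" by (simp only: less_eq_extended.simps(1))
    then have "\<alpha> g \<le> nat n" if "g \<in> G" for g
      using member_le_sum[OF that, of \<alpha>] finite_G by simp
    then have "restrict \<alpha> G \<in> E" by (simp add: E_def)
    moreover have "G_product G (restrict \<alpha> G) = G_product G \<alpha>"
      by (simp add: G_product_def)
    ultimately show "T \<in> (\<lambda>(\<alpha>, h). G_product G \<alpha> * h) ` (E \<times> H)"
      using T by (intro image_eqI[of _ _ "(restrict \<alpha> G, h)"]) auto
  qed
  moreover have "finite E" unfolding E_def using finite_G by (intro finite_PiE) auto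
  ultimately show ?thesis using assms(1) by (meson finite_SigmaI finite_imageI finite_subset)
qed

lemma G_product_add: "G_product G \<alpha> * G_product G \<beta> = G_product G (\<lambda>g. \<alpha> g + \<beta> g)"
  by (simp add: G_product_def power_add prod.distrib)

lemma G_product_single: "g \<in> G \<Longrightarrow> G_product G (\<lambda>x. if x = g then 1 else 0) = g"
  using finite_G by (simp add: G_product_def if_distrib[of "power _"] prod.delta cong: if_cong)

text \<open>
  A pair \<open>(k, T)\<close> can occur only once in a sequence of reductions, since it forces the value at
  \<open>k\<close> to grow beyond \<open>val k T\<close>. As only finitely many \<open>T\<close> have a given value, the sequence
  converges. If each step reduces at a \<open>k\<close> with the smallest possible value, the limit is
  irreducible: a reduction of the limit would be available at all late steps.
\<close>

lemma final_reduction_exists: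
  assumes H: "finite H" "H \<subseteq> O_bar" and u: "u \<in> O_bar" "u \<noteq> 0"
  obtains u' where "final_reduction H G u u'"
proof -
  define greedy where "greedy w p \<longleftrightarrow> k_reduction H G (fst p) w (snd p) \<and>
    (\<forall>k w'. k_reduction H G k w w' \<longrightarrow> val (fst p) w \<le> val k w)" for w p
  have greedy_ex: "\<exists>p. greedy w p" if red: "\<exists>w'. reduction H G w w'" for w
  proof -
    define K where "K = {k. \<exists>w'. k_reduction H G k w w'}"
    have "K \<noteq> {}" using red by (auto simp: K_def reduction_def)
    define k where "k = arg_min_on (\<lambda>k. val k w) K"
    have "k \<in> K" unfolding k_def using \<open>K \<noteq> {}\<close> by (intro arg_min_if_finite) auto
    moreover have "val k w \<le> val k' w" if "k' \<in> K" for k'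
      unfolding k_def using \<open>K \<noteq> {}\<close> that by (intro arg_min_least) auto
    ultimately show ?thesis by (auto simp: K_def greedy_def)
  qed
  define nxt where "nxt w = snd (SOME p. greedy w p)" for w
  define U where "U = rec_nat u (\<lambda>_. nxt)"
  have U0: "U 0 = u" and USuc: "U (Suc j) = nxt (U j)" for j by (simp_all add: U_def)
  define red where "red w \<longleftrightarrow> (\<exists>w'. reduction H G w w')" for w
  have nxt: "\<exists>k. greedy w (k, nxt w)" if "red w" for w
    using someI_ex[OF greedy_ex] that unfolding red_def nxt_def by (metis prod.collapse)
  have step: "reduction H G (U j) (U (Suc j))" if "red (U j)" for j
    using nxt[OF that] by (auto simp: greedy_def reduction_def USuc)
  show thesis
  proof (cases "\<forall>j. red (U j)")
    case False
    then obtain j where j: "\<not> red (U j)" "\<forall>l<j. red (U l)"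
      using exists_least_iff[of "\<lambda>j. \<not> red (U j)"] by auto
    have "(reduction H G)\<^sup>*\<^sup>* u (U l)" if "l \<le> j" for l
      using that
    proof (induction l)
      case (Suc l)
      then show ?case using step[of l] j(2) by (meson Suc_le_lessD less_imp_le rtranclp.rtrancl_into_rtrancl)
    qed (simp add: U0)
    then show ?thesis using j(1) u(2) unfolding red_def
      by (intro that[of "U j"]) (auto simp: final_reduction_def)
  next
    case True
    have "\<exists>k c T. T \<in> multiples H G \<and> U (Suc j) = U j - fls_const c *s T \<and>
        val k T = val k (U j) \<and> val k (U j) < val k (U (Suc j)) \<and>
        (\<forall>i. val i (U j) \<le> val i (U (Suc j))) \<and>
        (\<forall>k' w'. k_reduction H G k' (U j) w' \<longrightarrow> val k (U j) \<le> val k' (U j))" for j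
    proof -
      obtain k where "greedy (U j) (k, U (Suc j))" using nxt True by (auto simp: USuc)
      then have k: "k_reduction H G k (U j) (U (Suc j))"
        "\<forall>k' w'. k_reduction H G k' (U j) w' \<longrightarrow> val k (U j) \<le> val k' (U j)"
        by (auto simp: greedy_def)
      from k(1) show ?thesis by (rule k_reductionE) (use k(2) in blast)
    qed
    then obtain k c T where T: "\<And>j. T j \<in> multiples H G"
      and US: "\<And>j. U (Suc j) = U j - fls_const (c j) *s T j"
      and vT: "\<And>j. val (k j) (T j) = val (k j) (U j)"
      and less: "\<And>j. val (k j) (U j) < val (k j) (U (Suc j))"
      and le: "\<And>j i. val i (U j) \<le> val i (U (Suc j))"
      and min: "\<And>j k' w'. k_reduction H G k' (U j) w' \<Longrightarrow> val (k j) (U j) \<le> val k' (U j)"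
      by metis
    have mono: "val i (U j) \<le> val i (U l)" if "j \<le> l" for i j l
      using le that by (rule lift_Suc_mono_le)
    have inj: "inj (\<lambda>j. (k j, T j))"
    proof (rule linorder_injI)
      fix j l :: nat assume "j < l"
      then have "val (k j) (T j) < val (k j) (U l)"
        using less[of j] mono[of "Suc j" l "k j"] vT[of j] by (simp add: order_less_le_trans)
      then show "(k j, T j) \<noteq> (k l, T l)" using vT[of l] by auto
    qed
    have fin: "finite {j. \<exists>i. val i (T j) \<le> Fin n}" for n
    proof -
      have "finite (UNIV \<times> (\<Union>i. {T \<in> multiples H G. val i T \<le> Fin n}) :: ('i \<times> _) set)"
        using finite_multiples_bounded[OF H] by auto
      then have "finite ((\<lambda>j. (k j, T j)) -` (UNIV \<times> (\<Union>i. {T \<in> multiples H G. val i T \<le> Fin n})))"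
        using inj by (rule finite_vimageI)
      moreover have "{j. \<exists>i. val i (T j) \<le> Fin n} \<subseteq> \<dots>" using T by auto
      ultimately show ?thesis by (rule rev_finite_subset)
    qed
    have large: "eventually (\<lambda>j. \<forall>i. Fin n < val i (T j)) sequentially" for n
    proof -
      have "eventually (\<lambda>j. j \<notin> {j. \<exists>i. val i (T j) \<le> Fin n}) sequentially"
        using fin[of n] by (simp add: eventually_cofinite flip: cofinite_eq_sequentially)
      then show ?thesis by eventually_elim (auto simp: not_le)
    qed
    have "U j \<in> O_bar" for j
      using mono[of 0 j] u(1) by (auto simp: O_bar_iff U0 intro: order_trans)
    moreover have "eventually (\<lambda>j. Fin (int n) \<le> val i (U (Suc j) - U j)) sequentially" for n i
      using large[of "int n"]
    proof eventually_elim
      case (elim j)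
      have "U (Suc j) - U j = fls_const (- c j) *s T j"
        by (simp add: US vec_eq_iff)
      then show ?case using elim by (metis le_val_smult less_imp_le)
    qed
    ultimately obtain w where w: "U \<longlonglongrightarrow> w" using O_bar_convergent[of U] by blast
    have "\<not> red w"
    proof
      assume "red w"
      then obtain m T' where T': "T' \<in> multiples H G" "val m w \<noteq> Pinf" "val m T' = val m w"
        "\<And>i. val i w \<le> val i T'"
        unfolding red_def reducible_iff by blast
      from T'(2) obtain n where n: "val m w = Fin n" by (rule val_neq_PinfE)
      \<comment> \<open>\<open>N\<close> exceeds neither end of the comparison below: it is at least
        \<open>n\<close> and every finite value of \<open>T'\<close>. Infinite values of
        \<open>T'\<close> impose no condition, so they get the default 0.\<close>
      define b where "b i = (if val i T' = Pinf then 0 else fls_subdegree (T' $ i))" for i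
      define N where "N = max n (Max (range b))"
      have b: "val i T' = Pinf \<or> (\<exists>m\<le>N. val i T' = Fin m)" for i
      proof -
        have "b i \<le> N" unfolding N_def by (intro max.coboundedI2 Max_ge) auto
        then show ?thesis by (auto simp: b_def val_def split: if_splits)
      qed
      have "eventually (\<lambda>j. \<forall>i. Fin (N + 1) \<le> val i (U j - w)) sequentially"
        using w by (rule tendsto_vals_ge)
      moreover note large[of n]
      ultimately have "eventually (\<lambda>j. False) sequentially"
      proof eventually_elim
        case (elim j)
        have nth: "fls_nth (U j $ i) m = fls_nth (w $ i) m" if "m \<le> N" for i m
          using elim(1) that by (simp add: Fin_le_val_iff)
        have "n \<le> N" by (simp add: N_def)
        then have Um: "val m (U j) = Fin n"
          using n nth by (simp add: val_eq_Fin_iff)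
        \<comment> \<open>A value of \<open>U j\<close> above a finite value \<open>l\<close> of
          \<open>T'\<close> would force the same for \<open>w\<close>, as both agree up to order
          \<open>N\<close>.\<close>
        have "val i (U j) \<le> val i T'" for i
        proof (cases "val i T' = Pinf")
          case False
          with b obtain l where l: "l \<le> N" "val i T' = Fin l" by blast
          with T'(4)[of i] have "\<not> Fin l < val i w" by auto
          then have "\<not> Fin l < val i (U j)" using nth l(1) by (auto simp: less_val_iff_nth)
          then show ?thesis using l by simp
        qed simp
        then obtain w' where "k_reduction H G m (U j) w'"
          using k_reduction_exists[OF T'(1), of m "U j"] T'(3) n Um by auto
        \<comment> \<open>A reduction at \<open>m\<close> with value \<open>n\<close> is available,
          so the step chosen as smallest uses a multiple of value at most \<open>n\<close>. Late
          steps only use multiples with all values above \<open>n\<close>.\<close>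
        from min[OF this] have "val (k j) (T j) \<le> Fin n" using vT Um by simp
        then show False using elim(2) by (simp add: not_less[symmetric])
      qed
      then show False by simp
    qed
    then show ?thesis using U0 step True w u(2) unfolding red_def
      by (intro that[of w]) (auto simp: final_reduction_def)
  qed
qed

end


subsection \<open>The set of relevant \<open>S\<close>-processes\<close>

lemma S_process_smult:
  assumes "S_process H G k \<omega>"
  shows "S_process H G k (fls_const c *s \<omega>)"
proof -
  from assms obtain c1 c2 \<alpha>1 \<alpha>2 h1 h2 where h: "h1 \<in> H" "h2 \<in> H"
    and \<omega>: "\<omega> = fls_const c1 *s (G_product G \<alpha>1 * h1) + fls_const c2 *s (G_product G \<alpha>2 * h2)"
    and less: "min (val k (G_product G \<alpha>1 * h1)) (val k (G_product G \<alpha>2 * h2)) < val k \<omega>"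
    unfolding S_process_def by blast
  have "fls_const c *s \<omega> =
      fls_const (c * c1) *s (G_product G \<alpha>1 * h1) + fls_const (c * c2) *s (G_product G \<alpha>2 * h2)"
    unfolding \<omega> by (simp only: fls_vec.scale_right_distrib fls_vec.scale_scale)
  moreover have "val k \<omega> \<le> val k (fls_const c *s \<omega>)"
    by (rule le_val_smult) simp
  ultimately show ?thesis
    using h less unfolding S_process_def by (meson order_less_le_trans)
qed

lemma relevant_S_processes_smult:
  assumes "\<omega> \<in> relevant_S_processes H G \<sigma>" "c \<noteq> 0"
  shows "fls_const c *s \<omega> \<in> relevant_S_processes H G \<sigma>"
proof -
  from assms(1) obtain k i where "S_process H G k \<omega>" "val i \<omega> < Fin (int (\<sigma> i))"
    by (auto simp: relevant_S_processes_def)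
  moreover from this(1) have "S_process H G k (fls_const c *s \<omega>)" by (rule S_process_smult)
  ultimately show ?thesis using assms(2) by (auto simp: relevant_S_processes_def val_smult)
qed

lemma relevant_S_processes_nonzero: "0 \<notin> relevant_S_processes H G \<sigma>"
  by (simp add: relevant_S_processes_def)

text \<open>The punctured lines spanned by elements of \<open>A\<close> stay inside \<open>A\<close>
  and partition it. One element is chosen from each.\<close>

lemma scalar_representatives_exists:
  fixes A :: "('a::field fls ^ 'i::finite) set"
  assumes smult: "\<And>\<omega> c. \<omega> \<in> A \<Longrightarrow> c \<noteq> 0 \<Longrightarrow> fls_const c *s \<omega> \<in> A" and "0 \<notin> A"
  obtains S where "scalar_representatives A S"
proof -
  define line where "line \<omega> = {fls_const c *s \<omega> | c. c \<noteq> 0}" for \<omega> :: "'a fls ^ 'i"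
  have self: "\<omega> \<in> line \<omega>" for \<omega>
    using fls_vec.scale_one[of \<omega>] unfolding line_def by (metis (mono_tags, lifting) mem_Collect_eq one_neq_zero)
  have line_eq: "line \<omega>' = line \<omega>" if mem: "\<omega>' \<in> line \<omega>" for \<omega> \<omega>'
  proof -
    from mem obtain c where c: "c \<noteq> 0" "\<omega>' = fls_const c *s \<omega>" by (auto simp: line_def)
    show ?thesis
    proof (intro equalityI subsetI)
      fix w assume "w \<in> line \<omega>'"
      then obtain d where "d \<noteq> 0" "w = fls_const (d * c) *s \<omega>"
        unfolding line_def c(2) fls_vec.scale_scale by blast
      then show "w \<in> line \<omega>" using c(1) unfolding line_def by (metis (mono_tags, lifting) mem_Collect_eq mult_eq_0_iff)
    next
      fix w assume "w \<in> line \<omega>"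
      then obtain d where d: "d \<noteq> 0" "w = fls_const d *s \<omega>" unfolding line_def by blast
      then have "w = fls_const (d / c) *s \<omega>'" "d / c \<noteq> 0"
        unfolding c(2) fls_vec.scale_scale using c(1) by simp_all
      then show "w \<in> line \<omega>'" unfolding line_def by blast
    qed
  qed
  \<comment> \<open>The choice depends on the line alone, so proportional elements receive the same
    representative.\<close>
  define rep where "rep \<omega> = (SOME w. w \<in> line \<omega>)" for \<omega>
  have rep: "rep \<omega> \<in> line \<omega>" for \<omega> unfolding rep_def using self by (rule someI)
  have "scalar_representatives A (rep ` A)"
    unfolding scalar_representatives_def
  proof (intro conjI ballI)
    show "rep ` A \<subseteq> A"
    proof
      fix w assume "w \<in> rep ` A"
      then obtain \<omega> where "\<omega> \<in> A" "w = rep \<omega>" by auto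
      moreover obtain c where "c \<noteq> 0" "rep \<omega> = fls_const c *s \<omega>"
        using rep[of \<omega>] unfolding line_def by blast
      ultimately show "w \<in> A" using smult by simp
    qed
    fix \<omega> assume "\<omega> \<in> A"
    have rep_iff: "\<omega> \<in> line w \<longleftrightarrow> w = rep \<omega>" if "w \<in> rep ` A" for w
    proof
      from that obtain u where u: "w = rep u" by auto
      then have "line w = line u" using rep line_eq by auto
      moreover assume "\<omega> \<in> line w"
      then have "line \<omega> = line w" by (rule line_eq)
      ultimately show "w = rep \<omega>" by (simp add: u rep_def)
    qed (use line_eq[OF rep] self in auto)
    have "\<exists>!w. w \<in> rep ` A \<and> \<omega> \<in> line w"
    proof (rule ex1I)
      show "rep \<omega> \<in> rep ` A \<and> \<omega> \<in> line (rep \<omega>)" using rep_iff \<open>\<omega> \<in> A\<close> by blast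
    qed (use rep_iff in blast)
    then show "\<exists>!w. w \<in> rep ` A \<and> (\<exists>c. c \<noteq> 0 \<and> \<omega> = fls_const c *s w)"
      unfolding line_def mem_Collect_eq by (simp only: conj_commute)
  qed
  then show thesis by (rule that)
qed

text \<open>Representatives proportional to the same element of \<open>B\<close> are proportional to
  each other, hence equal by uniqueness. So \<open>S\<close> injects into \<open>B\<close>.\<close>

lemma finite_scalar_representatives:
  assumes S: "scalar_representatives A S" and "finite B"
    and AB: "\<And>\<omega>. \<omega> \<in> A \<Longrightarrow> \<exists>b\<in>B. \<exists>c. c \<noteq> 0 \<and> \<omega> = fls_const c *s b"
  shows "finite S"
proof -
  have SA: "S \<subseteq> A" using S by (simp add: scalar_representatives_def)
  then have "\<forall>\<omega>\<in>S. \<exists>b. b \<in> B \<and> (\<exists>c. c \<noteq> 0 \<and> \<omega> = fls_const c *s b)" using AB by blast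
  then obtain b where b: "\<And>\<omega>. \<omega> \<in> S \<Longrightarrow> b \<omega> \<in> B"
    "\<And>\<omega>. \<omega> \<in> S \<Longrightarrow> \<exists>c. c \<noteq> 0 \<and> \<omega> = fls_const c *s b \<omega>"
    using bchoice[of S "\<lambda>\<omega> b. b \<in> B \<and> (\<exists>c. c \<noteq> 0 \<and> \<omega> = fls_const c *s b)"] by blast
  have "inj_on b S"
  proof (rule inj_onI)
    fix \<omega> \<omega>' assume \<omega>: "\<omega> \<in> S" "\<omega>' \<in> S" "b \<omega> = b \<omega>'"
    then obtain c c' where c: "c \<noteq> 0" "c' \<noteq> 0" "\<omega> = fls_const c *s b \<omega>" "\<omega>' = fls_const c' *s b \<omega>"
      using b(2) by metis
    have "\<omega> = fls_const (c / c') *s \<omega>'" "c / c' \<noteq> 0"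
      using c(1,2) by (subst c(3), subst c(4), simp_all only: fls_vec.scale_scale) simp_all
    moreover have "\<omega> = fls_const 1 *s \<omega>" by (simp only: fls_vec.scale_one)
    moreover have "\<exists>!w. w \<in> S \<and> (\<exists>c. c \<noteq> 0 \<and> \<omega> = fls_const c *s w)"
      using S \<omega>(1) SA unfolding scalar_representatives_def by blast
    ultimately show "\<omega> = \<omega>'" using \<omega> one_neq_zero by metis
  qed
  moreover have "b ` S \<subseteq> B" using b(1) by auto
  ultimately show ?thesis using \<open>finite B\<close> by (meson finite_imageD finite_subset)
qed

text \<open>If both coefficients are nonzero, the leading terms at \<open>k\<close> must have equal
  order and cancel, which fixes the ratio of the coefficients. Up to a scalar the process is then
  determined by its two multiples and \<open>k\<close>.\<close>

lemma S_process_cases: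
  assumes "S_process H G k \<omega>"
  obtains (single) c T where "T \<in> multiples H G" "\<omega> = fls_const c *s T"
  | (pair) c T1 T2 n where "T1 \<in> multiples H G" "T2 \<in> multiples H G"
      "val k T1 = Fin n" "val k T2 = Fin n" "c \<noteq> 0"
      "\<omega> = fls_const c *s (T1 - fls_const (fls_nth (T1 $ k) n / fls_nth (T2 $ k) n) *s T2)"
proof -
  from assms obtain c1 c2 T1 T2 where T: "T1 \<in> multiples H G" "T2 \<in> multiples H G"
    and \<omega>: "\<omega> = fls_const c1 *s T1 + fls_const c2 *s T2"
    and less: "min (val k T1) (val k T2) < val k \<omega>"
    unfolding S_process_def by (metis multiplesI)
  show thesis
  proof (cases "c1 = 0 \<or> c2 = 0")
    case True
    then show ?thesis using T \<omega> single[of T1 c1] single[of T2 c2] by auto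
  next
    case False
    have "val k T1 = val k T2"
    proof (rule ccontr)
      assume neq: "val k T1 \<noteq> val k T2"
      define n where "n = min (val k T1) (val k T2)"
      have "n \<noteq> Pinf" using less by (auto simp: n_def)
      moreover have "n \<noteq> Minf" by (simp add: n_def min_def)
      ultimately obtain m where m: "n = Fin m" by (cases n) auto
      \<comment> \<open>With different values exactly one multiple has a coefficient at the smaller
        order \<open>m\<close>, and nothing can cancel it.\<close>
      have "fls_nth (T1 $ k) m = 0 \<longleftrightarrow> fls_nth (T2 $ k) m \<noteq> 0"
      proof (cases "val k T1 \<le> val k T2")
        case True
        then have "val k T1 < val k T2" using neq by simp
        with True have "val k T1 = Fin m" "Fin m < val k T2" using m unfolding n_def by (simp_all add: min_def)
        then show ?thesis by (simp add: val_eq_Fin_iff less_val_iff_nth)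
      next
        case False
        then have "val k T2 < val k T1" by simp
        with False have "val k T2 = Fin m" "Fin m < val k T1" using m unfolding n_def by (simp_all add: min_def)
        then show ?thesis by (simp add: val_eq_Fin_iff less_val_iff_nth)
      qed
      moreover have "fls_nth (\<omega> $ k) m = 0" using less m by (simp add: n_def less_val_iff_nth)
      ultimately show False using False unfolding \<omega> by (cases "fls_nth (T1 $ k) m = 0") auto
    qed
    moreover have "val k T1 \<noteq> Pinf" using less calculation by auto
    then obtain n where n: "val k T1 = Fin n" by (rule val_neq_PinfE)
    ultimately have n': "val k T2 = Fin n" by simp
    have "fls_nth (\<omega> $ k) n = 0" using less n n' by (simp add: less_val_iff_nth)
    then have "c1 * fls_nth (T1 $ k) n + c2 * fls_nth (T2 $ k) n = 0" by (simp add: \<omega>)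
    moreover have "fls_nth (T2 $ k) n \<noteq> 0" using n' by (simp add: val_eq_Fin_iff)
    ultimately have "c2 = - c1 * (fls_nth (T1 $ k) n / fls_nth (T2 $ k) n)"
      by (simp add: field_simps add_eq_0_iff2)
    then have "\<omega> = fls_const c1 *s (T1 - fls_const (fls_nth (T1 $ k) n / fls_nth (T2 $ k) n) *s T2)"
      unfolding \<omega> by (simp add: vec_eq_iff algebra_simps flip: fls_const_mult_const)
    with T n n' False show ?thesis by (intro pair[of T1 T2 n c1]) auto
  qed
qed

section \<open>Existence and finiteness of a single iteration\<close>

context monomials
begin

text \<open>A value below the conductor must come from one of the two multiples, which leaves
  finitely many choices for it. Its value at \<open>k\<close> is also that of its partner, so the
  partner is confined too.\<close>

lemma finite_relevant_representatives:
  assumes H: "finite H" "H \<subseteq> O_bar"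
    and S: "scalar_representatives (relevant_S_processes H G \<sigma>) S"
  shows "finite S"
proof -
  define M where "M n = (\<Union>k. {T \<in> multiples H G. val k T \<le> Fin n})" for n
  have finM: "finite (M n)" for n unfolding M_def using finite_multiples_bounded[OF H] by auto
  \<comment> \<open>\<open>M s\<close> contains every multiple with a value below the conductor.
    \<open>m\<close> bounds the orders of these at all branches, hence the order \<open>n\<close> of
    cancellation, so both partners lie in \<open>M m\<close>.\<close>
  define s where "s = Max (range (\<lambda>i. int (\<sigma> i)))"
  have s: "int (\<sigma> i) \<le> s" for i unfolding s_def by (intro Max_ge) auto
  define sd where "sd = (\<lambda>(T :: 'a fls ^ 'i, k). fls_subdegree (T $ k))"
  define m where "m = Max (insert s (sd ` (M s \<times> UNIV)))"
  have m: "s \<le> m" "\<And>T k. T \<in> M s \<Longrightarrow> fls_subdegree (T $ k) \<le> m"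
    unfolding m_def using finM by (auto simp: sd_def intro!: Max_ge)
  define B where "B = M s \<union> (\<lambda>(T1, T2, k, n). T1 - fls_const (fls_nth (T1 $ k) n / fls_nth (T2 $ k) n) *s T2)
    ` (M m \<times> M m \<times> UNIV \<times> {0..m})"
  have "finite B" unfolding B_def using finM by auto
  with S show ?thesis
  proof (rule finite_scalar_representatives)
    fix \<omega> assume "\<omega> \<in> relevant_S_processes H G \<sigma>"
    then obtain k i where k: "S_process H G k \<omega>" and i: "val i \<omega> < Fin (int (\<sigma> i))"
      by (auto simp: relevant_S_processes_def)
    have small: "T \<in> M s" if "T \<in> multiples H G" "val i T < Fin (int (\<sigma> i))" for T
    proof -
      have "val i T \<le> Fin s" using that(2) s[of i] by (cases "val i T") auto
      then show ?thesis using that(1) unfolding M_def by blast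
    qed
    from k show "\<exists>b\<in>B. \<exists>c. c \<noteq> 0 \<and> \<omega> = fls_const c *s b"
    proof (cases rule: S_process_cases)
      case (single c T)
      then have "c \<noteq> 0" using i by auto
      then have "T \<in> B" unfolding B_def using small single i by (simp add: val_smult)
      then show ?thesis using single \<open>c \<noteq> 0\<close> by blast
    next
      case (pair c T1 T2 n)
      let ?q = "fls_nth (T1 $ k) n / fls_nth (T2 $ k) n"
      have "val i T1 < Fin (int (\<sigma> i)) \<or> val i T2 < Fin (int (\<sigma> i))"
      proof (rule ccontr)
        assume "\<not> ?thesis"
        then have "Fin (int (\<sigma> i)) \<le> val i (T1 - fls_const ?q *s T2)"
          by (intro le_val_diff le_val_smult) auto
        then show False using i pair by (simp add: val_smult)
      qed
      then have "T1 \<in> M s \<or> T2 \<in> M s" using small pair by blast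
      moreover have "fls_subdegree (T1 $ k) = n" "fls_subdegree (T2 $ k) = n"
        using pair(3,4) by (auto simp: val_def split: if_splits)
      ultimately have "n \<le> m" using m(2)[of T1 k] m(2)[of T2 k] by auto
      then have "val k T1 \<le> Fin m" "val k T2 \<le> Fin m" using pair(3,4) by simp_all
      then have "T1 \<in> M m" "T2 \<in> M m" using pair(1,2) unfolding M_def by blast+
      moreover have "T1 \<in> O_bar" using pair(1) multiples_in_O_bar[OF H(2)] by auto
      then have "Fin 0 \<le> val k T1" unfolding O_bar_iff by blast
      then have "0 \<le> n" using pair(3) by simp
      ultimately have "T1 - fls_const ?q *s T2 \<in> B"
        unfolding B_def using \<open>n \<le> m\<close>
        by (intro UnI2 image_eqI[of _ _ "(T1, T2, k, n)"]) auto
      then show ?thesis using pair by blast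
    qed
  qed
qed

lemma iteration_exists:
  assumes H: "finite H" "H \<subseteq> O_bar"
  obtains H' where "iteration G \<sigma> H H'"
proof -
  let ?A = "relevant_S_processes H G \<sigma>"
  obtain S where S: "scalar_representatives ?A S"
    by (rule scalar_representatives_exists[of ?A])
      (use relevant_S_processes_smult relevant_S_processes_nonzero in blast)+
  have "\<exists>u'. final_reduction H G \<omega> u'" if "\<omega> \<in> S" for \<omega>
  proof -
    have \<omega>: "\<omega> \<in> ?A" using that S by (auto simp: scalar_representatives_def)
    then obtain c1 c2 \<alpha>1 \<alpha>2 h1 h2 where "h1 \<in> H" "h2 \<in> H"
      "\<omega> = fls_const c1 *s (G_product G \<alpha>1 * h1) + fls_const c2 *s (G_product G \<alpha>2 * h2)"
      unfolding relevant_S_processes_def S_process_def by blast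
    moreover have "G_product G \<alpha> * h \<in> O_bar" if "h \<in> H" for \<alpha> h
      using that multiplesI multiples_in_O_bar[OF H(2)] by blast
    ultimately have "\<omega> \<in> O_bar"
      by (auto simp: O_bar_iff intro!: le_val_add le_val_smult)
    moreover have "\<omega> \<noteq> 0" using \<omega> relevant_S_processes_nonzero by metis
    ultimately show ?thesis using final_reduction_exists[OF H] by metis
  qed
  then obtain \<rho> where "\<forall>\<omega>\<in>S. final_reduction H G \<omega> (\<rho> \<omega>)" by metis
  with S show thesis
    by (intro that[of "H \<union> {\<rho> \<omega> | \<omega>. \<omega> \<in> S \<and> \<rho> \<omega> \<noteq> 0}"]) (auto simp: iteration_def)
qed

lemma iteration_finite:
  assumes "iteration G \<sigma> H H'" "finite H" "H \<subseteq> O_bar"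
  shows "finite H'"
proof -
  from assms(1) obtain S \<rho> where S: "scalar_representatives (relevant_S_processes H G \<sigma>) S"
    and H': "H' = H \<union> {\<rho> \<omega> | \<omega>. \<omega> \<in> S \<and> \<rho> \<omega> \<noteq> 0}"
    unfolding iteration_def by blast
  have "finite S" using finite_relevant_representatives[OF assms(2,3) S] .
  moreover have "H' \<subseteq> H \<union> \<rho> ` S" using H' by auto
  ultimately show ?thesis using assms(2) by (metis finite_UnI finite_imageI finite_subset)
qed

end


subsection \<open>A criterion of Buchberger type\<close>

text \<open>At precision \<open>N\<close> the finite and infinite values of elements of
  \<open>W\<close> can be told apart: value at least \<open>N\<close> means a zero
  component.\<close>

lemma finite_vals_bounded:
  fixes W :: "('a::field fls ^ 'i::finite) set"
  assumes "finite W"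
  obtains N where "N \<ge> N0" "\<And>w i. w \<in> W \<Longrightarrow> val i w = Pinf \<or> val i w < Fin (int N)"
proof
  define B where "B = insert N0 ((\<lambda>(w, i). Suc (nat (fls_subdegree (w $ i)))) ` (W \<times> UNIV))"
  have "finite B" using assms by (simp add: B_def)
  then have B: "b \<le> Max B" if "b \<in> B" for b using that by (rule Max_ge)
  show "N0 \<le> Max B" by (rule B) (simp add: B_def)
  fix w i assume "w \<in> W"
  then have "Suc (nat (fls_subdegree (w $ i))) \<le> Max B"
    by (intro B) (auto simp: B_def)
  then show "val i w = Pinf \<or> val i w < Fin (int (Max B))"
    by (auto simp: val_def)
qed

context monomials
begin

text \<open>The tail of elements with all values at least \<open>N\<close> lets finite combinations
  stand for infinite sums of multiples. \<open>\<gamma>\<close> bounds the values of the multiples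
  used; raising it to the values of \<open>u\<close> removes the need for leading terms to
  cancel.\<close>

definition mspan :: "('a fls ^ 'i) set \<Rightarrow> ('i \<Rightarrow> nat) \<Rightarrow> nat \<Rightarrow> ('a fls ^ 'i) set" where
  "mspan H \<gamma> N = fls_vec.span
    ({T \<in> multiples H G. \<forall>i. Fin (int (\<gamma> i)) \<le> val i T} \<union> {z. \<forall>i. Fin (int N) \<le> val i z})"

lemma mspan_multiple:
  "T \<in> multiples H G \<Longrightarrow> (\<And>i. Fin (int (\<gamma> i)) \<le> val i T) \<Longrightarrow> T \<in> mspan H \<gamma> N"
  unfolding mspan_def by (rule fls_vec.span_base) simp

lemma mspan_tail: "(\<And>i. Fin (int N) \<le> val i z) \<Longrightarrow> z \<in> mspan H \<gamma> N"
  unfolding mspan_def by (rule fls_vec.span_base) simp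

lemma mspan_add: "u \<in> mspan H \<gamma> N \<Longrightarrow> w \<in> mspan H \<gamma> N \<Longrightarrow> u + w \<in> mspan H \<gamma> N"
  unfolding mspan_def by (rule fls_vec.span_add)

lemma mspan_smult: "u \<in> mspan H \<gamma> N \<Longrightarrow> fls_const c *s u \<in> mspan H \<gamma> N"
  unfolding mspan_def by (rule fls_vec.span_scale)

lemma mspan_mono:
  assumes "H \<subseteq> H'" "\<And>i. \<gamma>' i \<le> \<gamma> i"
  shows "mspan H \<gamma> N \<subseteq> mspan H' \<gamma>' N"
proof -
  have "Fin (int (\<gamma>' i)) \<le> x" if "Fin (int (\<gamma> i)) \<le> x" for i x
    using that assms(2)[of i] by (cases x) auto
  then show ?thesis
    unfolding mspan_def using multiples_mono[OF assms(1)] by (intro fls_vec.span_mono) blast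
qed

lemma mspan_induct [consumes 1, case_names zero add smult multiple tail]:
  assumes "u \<in> mspan H \<gamma> N"
    and "P 0" "\<And>u w. P u \<Longrightarrow> P w \<Longrightarrow> P (u + w)" "\<And>c u. P u \<Longrightarrow> P (fls_const c *s u)"
    and "\<And>T. T \<in> multiples H G \<Longrightarrow> (\<And>i. Fin (int (\<gamma> i)) \<le> val i T) \<Longrightarrow> P T"
    and "\<And>z. (\<And>i. Fin (int N) \<le> val i z) \<Longrightarrow> P z"
  shows "P u"
  using assms(1) unfolding mspan_def
proof (rule fls_vec.span_induct)
  show "fls_vec.subspace (Collect P)"
    unfolding fls_vec.subspace_def using assms(2-4) by simp
qed (use assms(5,6) in auto)

text \<open>
  The step of the induction: the multiples that attain the value \<open>\<gamma> k\<close> at \<open>k\<close> cancel in \<open>u\<close>,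
  so they can be traded for \<open>S\<^sub>k\<close>-processes with one of them, \<open>T0\<close>.
\<close>

lemma mspan_raise:
  assumes S: "\<And>s. S_process H G k s \<Longrightarrow> (\<And>i. Fin (int ((\<gamma>(k := Suc (\<gamma> k))) i)) \<le> val i s) \<Longrightarrow>
      s \<in> mspan H (\<gamma>(k := Suc (\<gamma> k))) N"
    and u: "u \<in> mspan H \<gamma> N" "Fin (int (\<gamma> k)) < val k u" and N: "\<gamma> k < N"
  shows "u \<in> mspan H (\<gamma>(k := Suc (\<gamma> k))) N"
proof -
  let ?\<gamma> = "\<gamma>(k := Suc (\<gamma> k))"
  define coef where "coef w = fls_nth (w $ k) (int (\<gamma> k))" for w :: "'a fls ^ 'i"
  have coef_simps: "coef 0 = 0" "coef (w + w') = coef w + coef w'" "coef (fls_const c *s w) = c * coef w"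
    for w w' :: "'a fls ^ 'i" and c
    by (simp_all add: coef_def)
  have raise: "Fin (int (?\<gamma> i)) \<le> val i w"
    if w: "\<And>i. Fin (int (\<gamma> i)) \<le> val i w" and w0: "coef w = 0" for w i
  proof (cases "i = k")
    case True
    have "fls_nth (w $ k) m = 0" if "m \<le> int (\<gamma> k)" for m
    proof (cases "m = int (\<gamma> k)")
      case False
      then show ?thesis using w[of k] that by (simp add: Fin_le_val_iff)
    qed (use w0 in \<open>simp add: coef_def\<close>)
    then show ?thesis using True by (simp add: Fin_le_val_iff)
  qed (use w in simp)
  have tail0: "coef z = 0" if "\<And>i. Fin (int N) \<le> val i z" for z
    using that[of k] N by (simp add: coef_def Fin_le_val_iff)
  have "coef u = 0" using u(2) by (simp add: coef_def less_val_iff_nth)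
  show ?thesis
  proof (cases "\<exists>T\<in>multiples H G. (\<forall>i. Fin (int (\<gamma> i)) \<le> val i T) \<and> coef T \<noteq> 0")
    case False
    from u(1) show ?thesis
    proof (induction rule: mspan_induct)
      case (multiple T)
      then have "coef T = 0" using False by blast
      with multiple show ?case by (intro mspan_multiple raise)
    qed (auto intro: mspan_add mspan_smult mspan_tail)
  next
    case True
    then obtain T0 where T0: "T0 \<in> multiples H G" "\<And>i. Fin (int (\<gamma> i)) \<le> val i T0" "coef T0 \<noteq> 0"
      by blast
    \<comment> \<open>Subtracting this multiple of \<open>T0\<close> is a linear map, so it can be
      checked on generators. It turns multiples into processes with \<open>T0\<close> and fixes
      \<open>u\<close>, because \<open>coef u = 0\<close>.\<close>
    have "w - fls_const (coef w / coef T0) *s T0 \<in> mspan H ?\<gamma> N" if "w \<in> mspan H \<gamma> N" for w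
      using that
    proof (induction rule: mspan_induct)
      case zero
      then show ?case by (auto simp: coef_simps intro: mspan_tail)
    next
      case (add w w')
      have "w + w' - fls_const (coef (w + w') / coef T0) *s T0 =
          (w - fls_const (coef w / coef T0) *s T0) + (w' - fls_const (coef w' / coef T0) *s T0)"
        by (simp add: coef_simps add_divide_distrib vec_eq_iff algebra_simps flip: fls_plus_const)
      with add show ?case using mspan_add by metis
    next
      case (smult c w)
      have "fls_const c *s w - fls_const (coef (fls_const c *s w) / coef T0) *s T0 =
          fls_const c *s (w - fls_const (coef w / coef T0) *s T0)"
        by (simp add: coef_simps vec_eq_iff algebra_simps flip: fls_const_mult_const)
      with smult show ?case using mspan_smult by metis
    next
      case (tail z)
      then show ?case using tail0[of z] by (auto intro: mspan_tail)
    next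
      case (multiple T)
      let ?s = "T - fls_const (coef T / coef T0) *s T0"
      have "Fin (int (\<gamma> i)) \<le> val i ?s" for i
        using multiple(2) T0(2) by (intro le_val_diff le_val_smult)
      moreover have "coef ?s = 0" using T0(3) by (simp add: coef_def)
      ultimately have s: "Fin (int (?\<gamma> i)) \<le> val i ?s" for i by (rule raise)
      have "val k T0 = Fin (int (\<gamma> k))"
        using T0(2)[of k] T0(3) by (simp add: coef_def val_eq_Fin_iff Fin_le_val_iff)
      then have "min (val k T) (val k T0) < val k ?s"
        using s[of k] by (auto simp: min_less_iff_disj intro: less_le_trans[rotated])
      moreover obtain \<alpha> h \<alpha>' h' where "h \<in> H" "T = G_product G \<alpha> * h" "h' \<in> H" "T0 = G_product G \<alpha>' * h'"
        using multiple(1) T0(1) by (auto simp: multiples_def)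
      moreover have "?s = fls_const 1 *s T + fls_const (- (coef T / coef T0)) *s T0"
        by (simp add: vec_eq_iff)
      ultimately have "S_process H G k ?s" unfolding S_process_def by blast
      then show ?case using s by (rule S)
    qed
    from this[OF u(1)] show ?thesis using \<open>coef u = 0\<close> by simp
  qed
qed

text \<open>The bound is raised by one unit at one branch at a time, by induction on the sum of
  \<open>\<gamma>\<close>. Staying at most \<open>N\<close> ensures that tails have no coefficient
  at the order being cancelled.\<close>

lemma mspan_refine:
  assumes S: "\<And>\<gamma> k s. S_process H G k s \<Longrightarrow> (\<And>i. Fin (int (\<gamma> i)) \<le> val i s) \<Longrightarrow> s \<in> mspan H \<gamma> N"
    and u: "u \<in> mspan H (\<lambda>_. 0) N"
    and \<gamma>: "\<And>i. Fin (int (\<gamma> i)) \<le> val i u" "\<And>i. \<gamma> i \<le> N"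
  shows "u \<in> mspan H \<gamma> N"
  using \<gamma>
proof (induction "\<Sum>i\<in>UNIV. \<gamma> i" arbitrary: \<gamma>)
  case 0
  then have "\<gamma> = (\<lambda>_. 0)" by auto
  then show ?case using u by simp
next
  case (Suc n)
  then obtain k where k: "\<gamma> k > 0" by (metis gr0I nat.distinct(1) sum.neutral)
  let ?\<gamma> = "\<gamma>(k := \<gamma> k - 1)"
  have "(\<Sum>i\<in>UNIV. \<gamma> i) = \<gamma> k + (\<Sum>i\<in>UNIV - {k}. \<gamma> i)"
    "(\<Sum>i\<in>UNIV. ?\<gamma> i) = \<gamma> k - 1 + (\<Sum>i\<in>UNIV - {k}. \<gamma> i)"
    by (auto simp: sum.remove[where x = k])
  then have sum: "n = (\<Sum>i\<in>UNIV. ?\<gamma> i)" using Suc(2) k by simp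
  have less: "Fin (int (\<gamma> k - 1)) < val k u"
    using Suc.prems(1)[of k] k by (cases "val k u") auto
  have "Fin (int (?\<gamma> i)) \<le> val i u" for i
    using Suc.prems(1)[of i] less by auto
  moreover have "?\<gamma> i \<le> N" for i using Suc.prems(2)[of i] by auto
  ultimately have "u \<in> mspan H ?\<gamma> N" using Suc(1) sum by blast
  moreover have "Fin (int (?\<gamma> k)) < val k u" "?\<gamma> k < N"
    using less k Suc.prems(2)[of k] by simp_all
  ultimately have "u \<in> mspan H (?\<gamma>(k := Suc (?\<gamma> k))) N"
    by - (rule mspan_raise[OF S])
  then show ?case using k by (simp add: fun_upd_idem)
qed

text \<open>
  Components of \<open>u\<close> that vanish are seen only up to the precision \<open>N\<close>. This is enough, since
  there are finitely many multiples with a given value at \<open>k\<close>, and \<open>N\<close> is chosen beyond all their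
  finite values.
\<close>

lemma reducible_of_mspan:
  assumes H: "finite H" "H \<subseteq> O_bar"
    and S: "\<And>N \<gamma> k s. N \<ge> N0 \<Longrightarrow> S_process H G k s \<Longrightarrow> (\<And>i. Fin (int (\<gamma> i)) \<le> val i s) \<Longrightarrow>
      s \<in> mspan H \<gamma> N"
    and u: "\<And>N. N \<ge> N0 \<Longrightarrow> u \<in> mspan H (\<lambda>_. 0) N" "u \<in> O_bar" "u \<noteq> 0"
  shows "\<exists>u'. reduction H G u u'"
proof -
  obtain k where "val k u \<noteq> Pinf" using u(3) val_eq_vec_zero by blast
  then obtain n where n: "val k u = Fin n" by (rule val_neq_PinfE)
  define F where "F = {T \<in> multiples H G. val k T \<le> Fin n}"
  have "finite (insert u F)" unfolding F_def using finite_multiples_bounded[OF H] by simp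
  then obtain N where N: "N \<ge> N0" "\<And>w i. w \<in> insert u F \<Longrightarrow> val i w = Pinf \<or> val i w < Fin (int N)"
    using finite_vals_bounded by metis
  have u0: "Fin 0 \<le> val i u" for i using u(2) by (simp add: O_bar_iff)
  define \<gamma> where "\<gamma> i = (if val i u = Pinf then N else nat (fls_subdegree (u $ i)))" for i
  have \<gamma>_fin: "val i u = Fin (int (\<gamma> i))" if "val i u \<noteq> Pinf" for i
    using that u0[of i] by (cases "u $ i = 0") (simp_all add: \<gamma>_def val_def)
  have \<gamma>: "Fin (int (\<gamma> i)) \<le> val i u \<and> \<gamma> i \<le> N" for i
  proof (cases "val i u = Pinf")
    case True
    then show ?thesis by (simp add: \<gamma>_def)
  next
    case False
    then show ?thesis using \<gamma>_fin[of i] N(2)[of u i] by simp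
  qed
  have "n < int N" using N(2)[of u k] n by simp
  have "u \<in> mspan H \<gamma> N"
    by (rule mspan_refine[OF S[OF N(1)] u(1)[OF N(1)]]) (use \<gamma> in auto)
  \<comment> \<open>The tails vanish at order \<open>n\<close>, so the nonzero coefficient of
    \<open>u\<close> there must come from one of the multiples spanning \<open>u\<close>.\<close>
  have "\<exists>T\<in>multiples H G. (\<forall>i. Fin (int (\<gamma> i)) \<le> val i T) \<and> fls_nth (T $ k) n \<noteq> 0"
  proof (rule ccontr)
    assume neg: "\<not> ?thesis"
    from \<open>u \<in> mspan H \<gamma> N\<close> have "fls_nth (u $ k) n = 0"
    proof (induction rule: mspan_induct)
      case (multiple T)
      then show ?case using neg by blast
    next
      case (tail z)
      from this[of k] show ?case using \<open>n < int N\<close> by (simp add: Fin_le_val_iff)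
    qed simp_all
    with n show False by (simp add: val_eq_Fin_iff)
  qed
  then obtain T where T: "T \<in> multiples H G" "\<And>i. Fin (int (\<gamma> i)) \<le> val i T" "fls_nth (T $ k) n \<noteq> 0"
    by blast
  have le_n: "val k T \<le> Fin n" using T(3) less_val_iff_nth[of n k T] by force
  then have "T \<in> F" using T(1) by (simp add: F_def)
  have "val k T = val k u"
    using le_n T(2)[of k] \<gamma>_fin[of k] n by auto
  moreover have "val i u \<le> val i T" for i
  proof (cases "val i u = Pinf")
    case True
    then have "Fin (int N) \<le> val i T" using T(2)[of i] by (simp add: \<gamma>_def)
    then show ?thesis using N(2)[of T i] \<open>T \<in> F\<close> by auto
  next
    case False
    then show ?thesis using T(2)[of i] \<gamma>_fin[of i] by simp
  qed
  ultimately show ?thesis using T(1) n unfolding reducible_iff by (metis extended.distinct(1))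
qed

text \<open>A multiple living on the branch \<open>k\<close> alone removes the leading term there
  without disturbing the others. Repeating this up to order \<open>N\<close> leaves a tail.\<close>

lemma tail_in_mspan:
  assumes single: "\<And>k n. n \<ge> \<tau> k \<Longrightarrow> \<exists>T\<in>multiples H G. val k T = Fin (int n) \<and> (\<forall>i. i \<noteq> k \<longrightarrow> T $ i = 0)"
    and z: "\<And>i. Fin (int (\<tau> i)) \<le> val i z" "\<And>i. Fin (int (\<gamma> i)) \<le> val i z"
  shows "z \<in> mspan H \<gamma> N"
proof -
  have axis: "w \<in> mspan H \<gamma> N"
    if "\<And>i. i \<noteq> k \<Longrightarrow> w $ i = 0" "Fin (int n) \<le> val k w" "\<tau> k \<le> n" "\<gamma> k \<le> n" for k n w
    using that
  proof (induction "N - n" arbitrary: n w)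
    case 0
    have "Fin (int N) \<le> val i w" for i
    proof (cases "i = k")
      case True
      then show ?thesis using 0 order_trans[of "Fin (int N)" "Fin (int n)" "val k w"] by simp
    next
      case False
      then have "val i w = Pinf" using 0 by (simp add: val_eq_Pinf_iff)
      then show ?thesis by simp
    qed
    then show ?case by (rule mspan_tail)
  next
    case (Suc m)
    obtain T where T: "T \<in> multiples H G" "val k T = Fin (int n)" "\<And>i. i \<noteq> k \<Longrightarrow> T $ i = 0"
      using single[OF Suc.prems(3)] by blast
    define c where "c = fls_nth (w $ k) (int n) / fls_nth (T $ k) (int n)"
    have "Fin (int (\<gamma> i)) \<le> val i T" for i
    proof (cases "i = k")
      case False
      then have "val i T = Pinf" using T by (simp add: val_eq_Pinf_iff)
      then show ?thesis by simp
    qed (use T(2) Suc.prems(4) in simp)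
    with T(1) have "T \<in> mspan H \<gamma> N" by (rule mspan_multiple)
    have "fls_nth (T $ k) (int n) \<noteq> 0" "\<And>m. m < int n \<Longrightarrow> fls_nth (T $ k) m = 0"
      using T(2) by (auto simp: val_eq_Fin_iff)
    then have "fls_nth ((w - fls_const c *s T) $ k) m = 0" if "m \<le> int n" for m
      using that Suc.prems(2) by (cases "m = int n") (auto simp: c_def Fin_le_val_iff)
    then have "Fin (int (Suc n)) \<le> val k (w - fls_const c *s T)"
      by (simp add: Fin_le_val_iff)
    then have "w - fls_const c *s T \<in> mspan H \<gamma> N"
      using Suc.prems Suc.hyps(2) T(3) by (intro Suc.hyps(1)[of "Suc n"]) auto
    from mspan_add[OF this mspan_smult[OF \<open>T \<in> mspan H \<gamma> N\<close>, of c]] show ?case by simp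
  qed
  \<comment> \<open>Each component is treated separately, starting where both the required multiples
    exist and the bound \<open>\<gamma>\<close> holds.\<close>
  have "(\<chi> i. if i = k then z $ k else 0) \<in> mspan H \<gamma> N" (is "?z k \<in> _") for k
  proof (rule axis[of k _ "max (\<tau> k) (\<gamma> k)"])
    have "Fin (int (max (\<tau> k) (\<gamma> k))) \<le> val k z" using z[of k] by (auto simp: max_def)
    then show "Fin (int (max (\<tau> k) (\<gamma> k))) \<le> val k (?z k)" by (subst val_cong[of _ _ z]) auto
  qed auto
  then have "(\<Sum>k\<in>UNIV. ?z k) \<in> mspan H \<gamma> N"
    unfolding mspan_def by (intro fls_vec.span_sum)
  moreover have "(\<Sum>k\<in>UNIV. ?z k) = z" by (simp add: vec_eq_iff)
  ultimately show ?thesis by simp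
qed

text \<open>A process with all values in the conductor is reached by the multiples living on one
  branch. Any other is proportional to a representative that reduces to zero, and the steps of this
  reduction express it by multiples of no smaller value.\<close>

lemma fixpoint_S_process_in_mspan:
  assumes fixpoint: "iteration G \<sigma> H H"
    and single: "\<And>k n. n \<ge> max (\<sigma> k) 1 \<Longrightarrow>
      \<exists>T\<in>multiples H G. val k T = Fin (int n) \<and> (\<forall>i. i \<noteq> k \<longrightarrow> T $ i = 0)"
    and H: "\<And>h i. h \<in> H \<Longrightarrow> Fin 1 \<le> val i h"
    and s: "S_process H G k s" "\<And>i. Fin (int (\<gamma> i)) \<le> val i s"
  shows "s \<in> mspan H \<gamma> N"
proof (cases "\<exists>i. val i s < Fin (int (\<sigma> i))")
  case False
  have T: "Fin 1 \<le> val i T" if T: "T \<in> multiples H G" for T i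
  proof -
    from T obtain \<alpha> h where "T = G_product G \<alpha> * h" "h \<in> H" by (auto simp: multiples_def)
    then show ?thesis using H G_product_in_O_bar[of \<alpha>]
      by (auto simp: O_bar_iff intro: le_val_mult_right)
  qed
  \<comment> \<open>This covers branches with \<open>\<sigma> i = 0\<close>, where the available
    multiples start only at value 1.\<close>
  have s1: "Fin 1 \<le> val i s" for i
    using s(1) T unfolding S_process_def
    by (auto intro!: le_val_add le_val_smult multiplesI)
  show ?thesis
  proof (rule tail_in_mspan[OF single])
    show "Fin (int (max (\<sigma> i) 1)) \<le> val i s" for i
      using False s1[of i] by (auto simp: max_def not_less)
  qed (use s(2) in auto)
next
  case True
  then have "s \<in> relevant_S_processes H G \<sigma>" using s(1) by (auto simp: relevant_S_processes_def)
  moreover obtain S \<rho> where S: "scalar_representatives (relevant_S_processes H G \<sigma>) S"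
    "\<And>\<omega>. \<omega> \<in> S \<Longrightarrow> final_reduction H G \<omega> (\<rho> \<omega>)" "H = H \<union> {\<rho> \<omega> | \<omega>. \<omega> \<in> S \<and> \<rho> \<omega> \<noteq> 0}"
    using fixpoint unfolding iteration_def by blast
  ultimately obtain \<omega> c where \<omega>: "\<omega> \<in> S" "c \<noteq> 0" "s = fls_const c *s \<omega>"
    unfolding scalar_representatives_def by metis
  \<comment> \<open>At a fixpoint a nonzero final reduction belongs to \<open>H\<close>, and would
    therefore be reducible by itself.\<close>
  have "\<rho> \<omega> = 0"
  proof (rule ccontr)
    assume nz: "\<rho> \<omega> \<noteq> 0"
    then have "\<rho> \<omega> \<in> multiples H G" using S(3) \<omega>(1) subset_multiples[of H G] by blast
    moreover obtain k where "val k (\<rho> \<omega>) \<noteq> Pinf" using nz val_eq_vec_zero by blast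
    ultimately have "\<exists>u'. reduction H G (\<rho> \<omega>) u'" unfolding reducible_iff by blast
    with S(2)[OF \<omega>(1)] show False by (auto simp: final_reduction_def)
  qed
  then have "final_reduction H G \<omega> 0" using S(2)[OF \<omega>(1)] by simp
  \<comment> \<open>\<open>P\<close> says that what has been subtracted so far lies in the span, and
    that the values never drop below \<open>\<gamma>\<close>.\<close>
  moreover define P where "P w \<longleftrightarrow> (\<forall>i. Fin (int (\<gamma> i)) \<le> val i w) \<and> \<omega> - w \<in> mspan H \<gamma> N" for w
  have "P \<omega>" using s(2) \<omega>(2,3) by (auto simp: P_def val_smult intro: mspan_tail)
  ultimately have "P 0"
  proof (rule final_reduction_invariant)
    fix w w' assume P: "P w" and "reduction H G w w'"
    then obtain k where "k_reduction H G k w w'" by (auto simp: reduction_def)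
    then obtain c T where T: "T \<in> multiples H G" "w' = w - fls_const c *s T"
      "\<And>i. val i w \<le> val i T" "\<And>i. val i w \<le> val i w'"
      by (rule k_reductionE) blast
    have ge: "Fin (int (\<gamma> i)) \<le> val i T" "Fin (int (\<gamma> i)) \<le> val i w'" for i
      using P T(3,4)[of i] unfolding P_def by (meson order_trans)+
    have "(\<omega> - w) + fls_const c *s T \<in> mspan H \<gamma> N"
      using P by (intro mspan_add mspan_smult mspan_multiple[OF T(1) ge(1)]) (simp add: P_def)
    moreover have "(\<omega> - w) + fls_const c *s T = \<omega> - w'" unfolding T(2) by simp
    ultimately show "P w'" using ge(2) by (simp add: P_def)
  next
    fix U w assume P: "\<And>j. P (U j)" and lim: "U \<longlonglongrightarrow> w"
    \<comment> \<open>A term this close to the limit differs from it by a tail that also respects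
      \<open>\<gamma>\<close>.\<close>
    define M where "M = Max (insert N (range \<gamma>))"
    have M: "N \<le> M" "\<gamma> i \<le> M" for i unfolding M_def by (rule Max_ge; simp)+
    from tendsto_vals_ge[OF lim, of "int M"] obtain j where j: "\<And>i. Fin (int M) \<le> val i (U j - w)"
      unfolding eventually_sequentially by blast
    have jN: "Fin (int N) \<le> val i (U j - w)" "Fin (int (\<gamma> i)) \<le> val i (U j - w)" for i
      using order_trans[OF _ j[of i]] M(1) M(2)[of i] by simp_all
    have "Fin (int (\<gamma> i)) \<le> val i (U j - (U j - w))" for i
      by (rule le_val_diff[OF _ jN(2)]) (use P[of j] in \<open>simp add: P_def\<close>)
    moreover have "(\<omega> - U j) + (U j - w) \<in> mspan H \<gamma> N"
      by (rule mspan_add[OF _ mspan_tail[OF jN(1)]]) (use P[of j] in \<open>simp add: P_def\<close>)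
    ultimately show "P w" by (simp add: P_def)
  qed
  then have "\<omega> \<in> mspan H \<gamma> N" by (simp add: P_def)
  then show ?thesis unfolding \<omega>(3) by (rule mspan_smult)
qed

end


subsection \<open>The derivation \<open>t d/dt\<close>\<close>

definition t_deriv :: "'a::field fls ^ 'i::finite \<Rightarrow> 'a fls ^ 'i" where
  "t_deriv u = (\<chi> i. fls_X * fls_deriv (u $ i))"

lemma t_deriv_nth: "fls_nth (t_deriv u $ i) n = of_int n * fls_nth (u $ i) n"
  by (simp add: t_deriv_def fls_X_times_conv_shift)

lemma t_deriv_add: "t_deriv (u + w) = t_deriv u + t_deriv w"
  by (simp add: t_deriv_def vec_eq_iff algebra_simps)

lemma t_deriv_smult: "t_deriv (fls_const c *s u) = fls_const c *s t_deriv u"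
  by (simp add: t_deriv_def vec_eq_iff algebra_simps fls_deriv_mult_const_left)

lemma t_deriv_mult: "t_deriv (u * w) = u * t_deriv w + w * t_deriv u"
  by (simp add: t_deriv_def vec_eq_iff algebra_simps)

lemma t_deriv_zero [simp]: "t_deriv 0 = 0"
  by (simp add: t_deriv_def vec_eq_iff)

lemma t_deriv_one [simp]: "t_deriv 1 = 0"
  by (simp add: t_deriv_def vec_eq_iff)

lemma le_val_t_deriv: "x \<le> val i u \<Longrightarrow> x \<le> val i (t_deriv u)"
  by (simp add: le_val_iff_nth t_deriv_nth)

text \<open>Each coefficient is scaled by its exponent. In characteristic zero only exponent 0 is
  lost, and there the coefficient is zero.\<close>

lemma val_t_deriv:
  fixes u :: "'a::field_char_0 fls ^ 'i::finite"
  assumes "Fin 1 \<le> val i u"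
  shows "val i (t_deriv u) = val i u"
proof (rule antisym)
  show "val i (t_deriv u) \<le> val i u"
    unfolding le_val_iff_nth
  proof (intro allI impI)
    fix m assume "Fin m < val i (t_deriv u)"
    then have "of_int m * fls_nth (u $ i) m = 0" by (simp add: less_val_iff_nth t_deriv_nth)
    moreover have "fls_nth (u $ i) 0 = 0" using assms by (simp add: Fin_le_val_iff)
    ultimately show "fls_nth (u $ i) m = 0" by (cases "m = 0") auto
  qed
qed (rule le_val_t_deriv, simp)


subsection \<open>Substitution of a parameterization\<close>

lemma fps_nth_mult_power_eq_0:
  fixes y :: "'a::comm_ring_1 fps"
  assumes "fps_nth y 0 = 0" "n < j"
  shows "fps_nth (a * y ^ j) n = 0"
proof -
  have "fps_nth (y ^ j) k = 0" if "k \<le> n" for k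
    using startsby_zero_power_prefix[OF assms(1)] that assms(2) by auto
  then show ?thesis by (simp add: fps_mult_nth)
qed

text \<open>The power \<open>y ^ j\<close> starts at order \<open>j\<close> or later, so any
  truncation from \<open>n\<close> on gives the same coefficient. A common \<open>m\<close> then
  serves all coefficients occurring in a product.\<close>

lemma subst2_nth:
  assumes "fps_nth y 0 = 0" "n \<le> m"
  shows "fps_nth (subst2 p (x, y)) n = fps_nth (\<Sum>j\<le>m. fps_compose (fps_nth p j) x * y ^ j) n"
proof -
  have "fps_nth (\<Sum>j\<le>m. fps_compose (fps_nth p j) x * y ^ j) n =
      (\<Sum>j\<le>m. fps_nth (fps_compose (fps_nth p j) x * y ^ j) n)"
    by (simp add: fps_sum_nth)
  also have "\<dots> = (\<Sum>j\<le>n. fps_nth (fps_compose (fps_nth p j) x * y ^ j) n)"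
    using assms by (intro sum.mono_neutral_right) (auto simp: fps_nth_mult_power_eq_0)
  finally show ?thesis by (simp add: subst2_def fps_sum_nth)
qed

lemma subst2_mult_nth:
  assumes "fps_nth y 0 = 0" "n \<le> m"
  shows "fps_nth (subst2 p (x, y) * z) n =
    fps_nth ((\<Sum>j\<le>m. fps_compose (fps_nth p j) x * y ^ j) * z) n"
  using assms by (simp add: fps_mult_nth subst2_nth[where m = m])

lemma subst2_add: "subst2 (p + q) \<phi> = subst2 p \<phi> + subst2 q \<phi>"
  by (cases \<phi>)
     (simp add: subst2_def fps_eq_iff fps_compose_add_distrib distrib_right sum.distrib)

lemma subst2_diff: "subst2 (p - q) \<phi> = subst2 p \<phi> - subst2 q \<phi>"
  by (cases \<phi>)
     (simp add: subst2_def fps_eq_iff fps_compose_sub_distrib left_diff_distrib sum_subtractf)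

text \<open>The coefficient of the left side is a sum over the triangle
  \<open>l + m \<le> n\<close>. The remaining terms of the square start above order
  \<open>n\<close>, and the sum over the square factors.\<close>

lemma subst2_mult:
  fixes p q :: "'a::idom fps fps"
  assumes "fps_nth x 0 = 0" and y: "fps_nth y 0 = 0"
  shows "subst2 (p * q) (x, y) = subst2 p (x, y) * subst2 q (x, y)"
proof (rule fps_ext)
  fix n
  define P where "P j = fps_compose (fps_nth p j) x" for j
  define Q where "Q j = fps_compose (fps_nth q j) x" for j
  define R where "R = (\<lambda>(l, m). P l * Q m * y ^ (l + m))"
  have "fps_compose (fps_nth (p * q) j) x * y ^ j = (\<Sum>l\<le>j. R (l, j - l))" for j
    by (simp add: fps_mult_nth fps_compose_sum_distrib fps_compose_mult_distrib[OF assms(1)]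
        P_def Q_def R_def sum_distrib_right atLeast0AtMost)
  then have "fps_nth (subst2 (p * q) (x, y)) n = fps_nth (\<Sum>j\<le>n. \<Sum>l\<le>j. R (l, j - l)) n"
    by (simp add: subst2_nth[OF y order_refl])
  also have "(\<Sum>j\<le>n. \<Sum>l\<le>j. R (l, j - l)) = (\<Sum>(l, m) | l + m \<le> n. R (l, m))"
    using sum.triangle_reindex_eq[of "\<lambda>l m. R (l, m)" n] by simp
  also have "fps_nth \<dots> n = fps_nth (\<Sum>(l, m)\<in>{..n} \<times> {..n}. R (l, m)) n"
    unfolding fps_sum_nth
    by (rule sum.mono_neutral_left)
       (auto simp: R_def, metis fps_nth_mult_power_eq_0[OF y] not_le)
  also have "(\<Sum>(l, m)\<in>{..n} \<times> {..n}. R (l, m)) = (\<Sum>l\<le>n. P l * y ^ l) * (\<Sum>m\<le>n. Q m * y ^ m)"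
    unfolding sum_product sum.cartesian_product
    by (intro sum.cong) (auto simp: R_def power_add algebra_simps)
  also have "fps_nth \<dots> n = fps_nth (subst2 p (x, y) * subst2 q (x, y)) n"
    unfolding fps_mult_nth P_def Q_def
    by (intro sum.cong arg_cong2[of _ _ _ _ "(*)"] subst2_nth[OF y, symmetric]) auto
  finally show "fps_nth (subst2 (p * q) (x, y)) n = fps_nth (subst2 p (x, y) * subst2 q (x, y)) n" .
qed

lemma subst2_const [simp]: "subst2 (fps_const a) (x, y) = fps_compose a x"
proof (rule fps_ext)
  fix n
  have "(\<Sum>j\<le>n. fps_compose (fps_nth (fps_const a) j) x * y ^ j) =
      (\<Sum>j\<le>n. if j = 0 then fps_compose a x else 0)"
    by (intro sum.cong) auto
  then show "fps_nth (subst2 (fps_const a) (x, y)) n = fps_nth (fps_compose a x) n"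
    by (simp add: subst2_def)
qed

lemma subst2_fps_X:
  assumes "fps_nth y 0 = 0"
  shows "subst2 fps_X (x, y) = (y :: 'a::comm_ring_1 fps)"
proof (rule fps_ext)
  fix n
  have "(\<Sum>j\<le>Suc n. fps_compose (fps_nth fps_X j) x * y ^ j) = (\<Sum>j\<le>Suc n. if j = 1 then y else 0)"
    by (intro sum.cong) auto
  then show "fps_nth (subst2 fps_X (x, y)) n = fps_nth y n"
    by (simp add: subst2_nth[OF assms, of n "Suc n"])
qed

lemma subst2_nth_0: "fps_nth (subst2 p \<phi>) 0 = fps_nth (fps_nth p 0) 0"
  by (cases \<phi>) (simp add: subst2_def)

text \<open>The chain rule, compared on truncations. Differentiation lowers orders by one, so the
  truncation of \<open>p\<close> runs to \<open>Suc n\<close>.\<close>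

lemma fps_deriv_subst2:
  fixes p :: "'a::field fps fps"
  assumes x: "fps_nth x 0 = 0" and y: "fps_nth y 0 = 0"
  shows "fps_deriv (subst2 p (x, y)) =
    subst2 (deriv_X p) (x, y) * fps_deriv x + subst2 (deriv_Y p) (x, y) * fps_deriv y"
proof (rule fps_ext)
  fix n
  define P where "P j = fps_compose (fps_nth p j) x" for j
  define P' where "P' j = fps_compose (fps_nth (deriv_X p) j) x" for j
  have P': "fps_deriv (P j) = P' j * fps_deriv x" for j
    using fps_compose_deriv[OF x] by (simp add: P_def P'_def deriv_X_def)
  have dY: "fps_compose (fps_nth (deriv_Y p) j) x = of_nat (Suc j) * P (Suc j)" for j
  proof -
    have "fps_nth (deriv_Y p) j = of_nat (Suc j) * fps_nth p (Suc j)"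
      by (simp add: deriv_Y_def)
    then show ?thesis
      by (simp only: P_def fps_compose_mult_distrib[OF x] fps_compose_of_nat)
  qed
  have dpow: "fps_deriv (y ^ Suc j) = of_nat (Suc j) * y ^ j * fps_deriv y" for j
    unfolding fps_deriv_power fps_of_nat by (simp add: mult_ac del: of_nat_Suc)
  have "fps_nth (fps_deriv (subst2 p (x, y))) n = fps_nth (fps_deriv (\<Sum>j\<le>Suc n. P j * y ^ j)) n"
    by (simp add: subst2_nth[OF y order_refl] P_def del: sum.atMost_Suc)
  also have "fps_deriv (\<Sum>j\<le>Suc n. P j * y ^ j) =
      (\<Sum>j\<le>Suc n. P' j * y ^ j) * fps_deriv x + (\<Sum>j\<le>Suc n. P j * fps_deriv (y ^ j))"
    by (simp add: fps_deriv_sum P' sum.distrib sum_distrib_left algebra_simps del: sum.atMost_Suc)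
  also have "(\<Sum>j\<le>Suc n. P j * fps_deriv (y ^ j)) =
      (\<Sum>j\<le>n. fps_compose (fps_nth (deriv_Y p) j) x * y ^ j) * fps_deriv y"
    unfolding sum.atMost_Suc_shift
    by (simp add: dY dpow sum_distrib_left mult_ac del: power_Suc of_nat_Suc)
  also have "fps_nth ((\<Sum>j\<le>Suc n. P' j * y ^ j) * fps_deriv x + \<dots>) n =
      fps_nth (subst2 (deriv_X p) (x, y) * fps_deriv x + subst2 (deriv_Y p) (x, y) * fps_deriv y) n"
    unfolding P'_def fps_add_nth
    by (intro arg_cong2[of _ _ _ _ "(+)"] subst2_mult_nth[OF y, symmetric]) auto
  finally show "fps_nth (fps_deriv (subst2 p (x, y))) n = fps_nth
      (subst2 (deriv_X p) (x, y) * fps_deriv x + subst2 (deriv_Y p) (x, y) * fps_deriv y) n" .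
qed


subsection \<open>The procedure over the local ring of a curve\<close>

lemma smult_minus_one: "fls_const (- 1) *s u = - u"
  for u :: "'a::field fls ^ 'i::finite"
  by (simp add: vec_eq_iff)

text \<open>\<open>R\<close> stands for the image of the local ring in Q, and \<open>x\<close>,
  \<open>y\<close> for the images of the coordinates. The last assumption is the chain rule for the
  generators.\<close>

locale curve_ring = monomials G for G :: "('a::field_char_0 fls ^ 'i::finite) set" +
  fixes R :: "('a fls ^ 'i) set" and \<sigma> :: "'i \<Rightarrow> nat" and x y :: "'a fls ^ 'i"
  assumes R_O_bar: "R \<subseteq> O_bar"
    and R_one: "1 \<in> R"
    and R_add: "u \<in> R \<Longrightarrow> w \<in> R \<Longrightarrow> u + w \<in> R"
    and R_mult: "u \<in> R \<Longrightarrow> w \<in> R \<Longrightarrow> u * w \<in> R"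
    and R_smult: "u \<in> R \<Longrightarrow> fls_const c *s u \<in> R"
    and G_R: "G \<subseteq> R" and G_nonzero: "0 \<notin> G"
    and R_xy: "x \<in> R" "y \<in> R"
    and R_conductor: "(\<And>i. Fin (int (\<sigma> i)) \<le> val i z) \<Longrightarrow> z \<in> R"
    and R_reducible: "u \<in> R \<Longrightarrow> u \<noteq> 0 \<Longrightarrow> \<exists>u'. reduction {1} G u u'"
    and t_deriv_G_xy: "g \<in> G \<Longrightarrow> \<exists>p\<in>R. \<exists>q\<in>R. t_deriv g = p * t_deriv x + q * t_deriv y"
begin

text \<open>This is the image of the differentials under \<open>phi_star\<close>; the factor
  \<open>t\<close> of that map is the one contained in \<open>t_deriv\<close>.\<close>

definition M :: "('a fls ^ 'i) set" where
  "M = {p * t_deriv x + q * t_deriv y | p q. p \<in> R \<and> q \<in> R}"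

lemma M_I: "p \<in> R \<Longrightarrow> q \<in> R \<Longrightarrow> p * t_deriv x + q * t_deriv y \<in> M"
  by (auto simp: M_def)

lemma M_E:
  assumes "u \<in> M" obtains p q where "p \<in> R" "q \<in> R" "u = p * t_deriv x + q * t_deriv y"
  using assms by (auto simp: M_def)

lemma R_diff: "u \<in> R \<Longrightarrow> w \<in> R \<Longrightarrow> u - w \<in> R"
  using R_add[OF _ R_smult[of w "- 1"]] by (simp add: smult_minus_one del: fls_const_uminus)

lemma R_val: "u \<in> R \<Longrightarrow> Fin 0 \<le> val i u"
  using R_O_bar by (auto simp: O_bar_iff)

lemma R_G_product: "G_product G \<alpha> \<in> R"
proof -
  have pow: "g ^ n \<in> R" if "g \<in> G" for g n
    using that G_R by (induction n) (auto intro: R_one R_mult)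
  have "(\<Prod>g\<in>A. g ^ \<alpha> g) \<in> R" if "finite A" "A \<subseteq> G" for A
    using that by (induction A rule: finite_induct) (auto intro: R_one R_mult pow)
  then show ?thesis using finite_G by (simp add: G_product_def)
qed

lemma val_t_deriv_pos: "u \<in> R \<Longrightarrow> Fin 1 \<le> val i (t_deriv u)"
  using R_val[of u i] unfolding Fin_le_val_iff t_deriv_nth
  by (metis int_one_le_iff_zero_less linorder_neqE_linordered_idom linorder_not_less mult_eq_0_iff of_int_0)

lemma M_val: "u \<in> M \<Longrightarrow> Fin 1 \<le> val i u"
  by (erule M_E) (simp add: le_val_add le_val_mult_right R_val val_t_deriv_pos R_xy)

lemma M_O_bar: "M \<subseteq> O_bar"
proof
  fix u assume "u \<in> M"
  then have "Fin 0 \<le> val i u" for i by (intro order_trans[OF _ M_val]) simp_all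
  then show "u \<in> O_bar" by (simp add: O_bar_iff)
qed

lemma M_add: "u \<in> M \<Longrightarrow> w \<in> M \<Longrightarrow> u + w \<in> M"
proof (elim M_E)
  fix p q p' q'
  assume *: "p \<in> R" "q \<in> R" "p' \<in> R" "q' \<in> R"
    and "u = p * t_deriv x + q * t_deriv y" "w = p' * t_deriv x + q' * t_deriv y"
  then have "u + w = (p + p') * t_deriv x + (q + q') * t_deriv y" by (simp add: algebra_simps)
  then show ?thesis using * by (simp add: M_I R_add)
qed

lemma M_mult: "u \<in> R \<Longrightarrow> w \<in> M \<Longrightarrow> u * w \<in> M"
proof (elim M_E)
  fix p q
  assume *: "u \<in> R" "p \<in> R" "q \<in> R" and "w = p * t_deriv x + q * t_deriv y"
  then have "u * w = (u * p) * t_deriv x + (u * q) * t_deriv y" by (simp add: algebra_simps)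
  then show ?thesis using * by (simp add: M_I R_mult)
qed

lemma M_smult: "u \<in> M \<Longrightarrow> fls_const c *s u \<in> M"
proof -
  assume "u \<in> M"
  then have "(fls_const c *s 1) * u \<in> M" by (intro M_mult R_smult R_one)
  moreover have "(fls_const c *s 1) * u = fls_const c *s u" by (simp add: vec_eq_iff)
  ultimately show ?thesis by simp
qed

lemma M_diff: "u \<in> M \<Longrightarrow> w \<in> M \<Longrightarrow> u - w \<in> M"
  using M_add[OF _ M_smult[of w "- 1"]] by (simp add: smult_minus_one del: fls_const_uminus)

lemma M_zero: "0 \<in> M"
  using M_I[OF R_smult[OF R_one, of 0] R_smult[OF R_one, of 0]] by simp

lemma M_t_deriv_G: "t_deriv ` G \<subseteq> M"
proof
  fix u assume "u \<in> t_deriv ` G"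
  then obtain g p q where "p \<in> R" "q \<in> R" "u = p * t_deriv x + q * t_deriv y"
    using t_deriv_G_xy by blast
  then show "u \<in> M" using M_I by simp
qed

lemma multiples_M: "H \<subseteq> M \<Longrightarrow> multiples H G \<subseteq> M"
  by (auto simp: multiples_def intro!: M_mult R_G_product)

text \<open>
  The element of the conductor with the single component \<open>t\<^sup>n\<close> has the value of a \<open>G\<close>-product
  \<open>g * b\<close>, and \<open>t_deriv g\<close> has the same value as \<open>g\<close> at every branch.
\<close>

lemma single_multiple:
  assumes n: "max (\<sigma> k) 1 \<le> n"
  obtains T where "T \<in> multiples (t_deriv ` G) G" "val k T = Fin (int n)" "\<And>i. i \<noteq> k \<Longrightarrow> T $ i = 0"
proof -
  define z where "z = ((\<chi> i. if i = k then fls_X ^ n else 0) :: 'a fls ^ 'i)"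
  have zk: "val k z = Fin (int n)" by (simp add: z_def val_def)
  have zi: "val i z = Pinf" if "i \<noteq> k" for i using that by (simp add: z_def val_def)
  have "Fin (int (\<sigma> i)) \<le> val i z" for i using zk zi n by (cases "i = k") auto
  then have "z \<in> R" by (rule R_conductor)
  moreover have "z \<noteq> 0" using zk by auto
  ultimately obtain k' T where T: "T \<in> multiples {1} G" "val k' z \<noteq> Pinf" "val k' T = val k' z"
    "\<And>i. val i z \<le> val i T"
    using R_reducible unfolding reducible_iff by blast
  have "k' = k" using T(2) zi by blast
  then have Tk: "val k T = Fin (int n)" using T(3) zk by simp
  obtain \<alpha> where \<alpha>: "T = G_product G \<alpha>" using T(1) by (auto simp: multiples_def)
  \<comment> \<open>The empty product has value 0, which \<open>n \<ge> 1\<close> excludes, so there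
    is a factor to exchange for its derivative.\<close>
  have "\<exists>g\<in>G. \<alpha> g \<noteq> 0"
  proof (rule ccontr)
    assume "\<not> ?thesis"
    then have "T = 1" by (simp add: \<alpha> G_product_def)
    then show False using Tk n by (simp add: zero_extended_def)
  qed
  then obtain g where g: "g \<in> G" "\<alpha> g \<noteq> 0" by blast
  let ?\<beta> = "\<alpha>(g := \<alpha> g - 1)"
  have "\<alpha> = (\<lambda>h. ?\<beta> h + (if h = g then 1 else 0))" using g by (intro ext) simp
  from arg_cong[OF this, of "G_product G"] have T_eq: "T = G_product G ?\<beta> * g"
    unfolding \<alpha> G_product_add[symmetric] G_product_single[OF g(1)] .
  let ?T = "G_product G ?\<beta> * t_deriv g"
  have val_eq: "val i ?T = val i T" for i
    by (simp only: T_eq val_mult val_t_deriv[OF val_G[OF g(1)]])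
  show thesis
  proof (rule that[of ?T])
    show "?T \<in> multiples (t_deriv ` G) G" using g(1) by (intro multiplesI) auto
    show "val k ?T = Fin (int n)" using val_eq Tk by simp
    show "?T $ i = 0" if "i \<noteq> k" for i
      using T(4)[of i] zi[OF that] val_eq[of i] unfolding val_eq_Pinf_iff[symmetric] by simp
  qed
qed

text \<open>Let \<open>T k\<close> in \<open>M\<close> live on branch \<open>k\<close> with value
  \<open>n k\<close>. Dividing a component of value at least \<open>\<sigma> k + n k\<close> by it
  leaves a quotient in the conductor, so \<open>z\<close> is a combination of the \<open>T k\<close>
  over \<open>R\<close>.\<close>

lemma M_contains_tail:
  obtains b where "\<And>z. (\<And>i. Fin (int b) \<le> val i z) \<Longrightarrow> z \<in> M"
proof -
  define n where "n k = max (\<sigma> k) 1" for k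
  have "\<exists>T. T \<in> M \<and> val k T = Fin (int (n k)) \<and> (\<forall>i. i \<noteq> k \<longrightarrow> T $ i = 0)" for k
    using single_multiple[of k "n k"] multiples_M[OF M_t_deriv_G] unfolding n_def
    by (metis order_refl subsetD)
  then obtain T where T: "\<And>k. T k \<in> M" "\<And>k. val k (T k) = Fin (int (n k))"
    "\<And>k i. i \<noteq> k \<Longrightarrow> T k $ i = 0"
    by metis
  have T_nz: "T k $ k \<noteq> 0" for k using T(2)[of k] val_eq_Pinf_iff[of k "T k"] by auto
  define b where "b = Max (range (\<lambda>k. \<sigma> k + n k))"
  have b: "\<sigma> k + n k \<le> b" for k unfolding b_def by (intro Max_ge) auto
  show thesis
  proof (rule that)
    fix z :: "'a fls ^ 'i" assume z: "\<And>i. Fin (int b) \<le> val i z"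
    define w where "w k = (\<chi> i. if i = k then z $ k / T k $ k else 0)" for k :: 'i
    have "Fin (int (\<sigma> i)) \<le> val i (w k)" for i k
    proof (cases "i = k \<and> z $ k \<noteq> 0")
      case True
      have "val k z = val k (w k * T k)"
        using T_nz by (intro val_cong) (simp add: w_def)
      then have "val k z = val k (w k) + Fin (int (n k))" by (simp add: val_mult T(2))
      then have "Fin (int b) \<le> val k (w k) + Fin (int (n k))" using z[of k] by simp
      then show ?thesis using b[of k] True by (cases "val k (w k)") auto
    next
      case False
      then have "w k $ i = 0" by (auto simp: w_def)
      then have "val i (w k) = Pinf" by (simp add: val_eq_Pinf_iff)
      then show ?thesis by simp
    qed
    then have "w k \<in> R" for k by (rule R_conductor)
    then have "w k * T k \<in> M" for k using T(1) by (rule M_mult)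
    moreover have "(\<Sum>k\<in>A. u k) \<in> M" if "\<And>k. u k \<in> M" "finite A" for A :: "'i set" and u
      using that(2) by (induction A rule: finite_induct) (auto intro: M_zero M_add that(1))
    ultimately have "(\<Sum>k\<in>UNIV. w k * T k) \<in> M" by simp
    moreover have comp: "(\<Sum>k\<in>UNIV. w k * T k) $ i = z $ i" for i
    proof -
      have "(\<Sum>k\<in>UNIV. w k * T k) $ i = (\<Sum>k\<in>UNIV. if k = i then z $ i else 0)"
        unfolding sum_component by (rule sum.cong) (use T_nz in \<open>auto simp: w_def\<close>)
      then show ?thesis by simp
    qed
    moreover have "(\<Sum>k\<in>UNIV. w k * T k) = z" unfolding vec_eq_iff using comp by blast
    ultimately show "z \<in> M" by simp
  qed
qed

text \<open>A late member of the sequence differs from the limit by an element of the tail contained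
  in \<open>M\<close>. Limits of infinite reductions therefore stay in \<open>M\<close>.\<close>

lemma M_closed:
  assumes "\<And>j. U j \<in> M" "U \<longlonglongrightarrow> w"
  shows "w \<in> M"
proof -
  obtain b where b: "\<And>z. (\<And>i. Fin (int b) \<le> val i z) \<Longrightarrow> z \<in> M"
    using M_contains_tail by blast
  obtain j where "\<And>i. Fin (int b) \<le> val i (U j - w)"
    using tendsto_vals_ge[OF assms(2), of "int b"] unfolding eventually_sequentially by blast
  then have "U j - w \<in> M" by (rule b)
  from M_diff[OF assms(1) this] have "U j - (U j - w) \<in> M" .
  then show ?thesis by simp
qed

lemma final_reduction_M:
  assumes "final_reduction H G u u'" "u \<in> M" "H \<subseteq> M"
  shows "u' \<in> M"
  using assms(1,2)
proof (rule final_reduction_invariant[where P = "\<lambda>u. u \<in> M"])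
  fix w w' assume w: "w \<in> M" "reduction H G w w'"
  then obtain k where "k_reduction H G k w w'" by (auto simp: reduction_def)
  then obtain c T where "T \<in> multiples H G" "w' = w - fls_const c *s T"
    by (rule k_reductionE) blast
  then show "w' \<in> M" using w(1) multiples_M[OF assms(3)] by (auto intro: M_diff M_smult)
qed (rule M_closed)


subsection \<open>Approximation by combinations of \<open>G\<close>-products\<close>

text \<open>
  Components of value at least \<open>N\<close> are dropped before each reduction. Otherwise a sequence of
  reductions could act forever on components that already vanish to order \<open>N\<close>.
\<close>

lemma R_approx:
  assumes N: "\<And>i. \<sigma> i \<le> N" and u: "u \<in> R"
  shows "u \<in> mspan {1} (\<lambda>_. 0) N"
proof -
  \<comment> \<open>\<open>d\<close> counts the orders still to be gained at branch \<open>i\<close>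
    before \<open>N\<close>.\<close>
  define d where "d i w = (if Fin (int N) \<le> val i w then 0 else N - nat (fls_subdegree (w $ i)))"
    for i and w :: "'a fls ^ 'i"
  show ?thesis using u
  proof (induction "\<Sum>i\<in>UNIV. d i u" arbitrary: u rule: less_induct)
    case less
    define v where "v = (\<chi> i. if Fin (int N) \<le> val i u then 0 else u $ i)"
    have v: "v $ i = (if Fin (int N) \<le> val i u then 0 else u $ i)" for i by (simp add: v_def)
    have rest: "Fin (int N) \<le> val i (u - v)" for i
      by (cases "Fin (int N) \<le> val i u") (auto simp: Fin_le_val_iff v)
    have "Fin (int (\<sigma> i)) \<le> val i (u - v)" for i
      using N[of i] by (intro order_trans[OF _ rest]) simp
    then have "u - v \<in> R" by (rule R_conductor)
    from R_diff[OF less.prems this] have "v \<in> R" by simp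
    have "v \<in> mspan {1} (\<lambda>_. 0) N"
    proof (cases "v = 0")
      case True
      then show ?thesis by (auto intro: mspan_tail)
    next
      case False
      then obtain k v' where "k_reduction {1} G k v v'"
        using R_reducible \<open>v \<in> R\<close> unfolding reduction_def by blast
      then obtain c T where T: "T \<in> multiples {1} G" and v': "v' = v - fls_const c *s T"
        and k: "val k v \<noteq> Pinf" "val k v < val k v'" and ge: "\<And>i. val i v \<le> val i v'"
        by (rule k_reductionE) blast
      have T_R: "T \<in> R" using T R_G_product by (auto simp: multiples_def)
      then have "v' \<in> R" unfolding v' using \<open>v \<in> R\<close> by (intro R_diff R_smult)
      have d_le: "d i v' \<le> d i u" for i
      proof (cases "Fin (int N) \<le> val i u")
        case True
        then have "val i v = Pinf" by (simp add: val_eq_Pinf_iff v)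
        then show ?thesis using ge[of i] by (simp add: d_def)
      next
        case False
        then have "val i v = val i u" by (intro val_cong) (simp add: v)
        then show ?thesis using ge[of i] False by (auto simp: d_def val_def split: if_splits)
      qed
      have "d k v' < d k u"
      proof -
        \<comment> \<open>The component at \<open>k\<close> survived the cut, so its value was below
          \<open>N\<close> and \<open>d\<close> strictly drops.\<close>
        have small: "\<not> Fin (int N) \<le> val k u" using k(1) by (auto simp: val_eq_Pinf_iff v)
        then have eq: "val k v = val k u" by (intro val_cong) (simp add: v)
        have "0 \<le> fls_subdegree (u $ k)"
          using R_val[OF less.prems, of k] k(1) eq by (auto simp: val_def split: if_splits)
        then show ?thesis using small k eq by (auto simp: d_def val_def split: if_splits)
      qed
      then have "(\<Sum>i\<in>UNIV. d i v') < (\<Sum>i\<in>UNIV. d i u)"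
        using d_le by (intro sum_strict_mono_ex1) auto
      then have "v' \<in> mspan {1} (\<lambda>_. 0) N" using less.hyps \<open>v' \<in> R\<close> by blast
      moreover have "T \<in> mspan {1} (\<lambda>_. 0) N"
        using T R_val[OF T_R] by (intro mspan_multiple) auto
      ultimately have "v' + fls_const c *s T \<in> mspan {1} (\<lambda>_. 0) N"
        by (intro mspan_add mspan_smult)
      then show ?thesis by (simp add: v')
    qed
    from mspan_add[OF this mspan_tail[OF rest]] show ?case by simp
  qed
qed

lemma mspan_O_bar: "u \<in> mspan H (\<lambda>_. 0) N \<Longrightarrow> u \<in> O_bar"
proof (induction rule: mspan_induct)
  case (tail z)
  then show ?case by (auto simp: O_bar_iff intro: order_trans[of _ "Fin (int N)"])
qed (auto simp: O_bar_iff intro: le_val_add le_val_smult)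

text \<open>A \<open>G\<close>-product times a multiple is again a multiple, and factors without
  poles keep tails beyond order \<open>N\<close>.\<close>

lemma mspan_mult:
  assumes u: "u \<in> mspan {1} (\<lambda>_. 0) N" and w: "w \<in> mspan H (\<lambda>_. 0) N"
  shows "u * w \<in> mspan H (\<lambda>_. 0) N"
proof -
  have mult_tail: "z * z' \<in> mspan H (\<lambda>_. 0) N"
    if "z \<in> O_bar" "\<And>i. Fin (int N) \<le> val i z'" for z z'
    using that by (intro mspan_tail le_val_mult_right) (auto simp: O_bar_iff)
  have G_product: "G_product G \<alpha> * w \<in> mspan H (\<lambda>_. 0) N" for \<alpha>
    using w
  proof (induction rule: mspan_induct)
    case (multiple T)
    then obtain \<beta> h where T: "h \<in> H" "T = G_product G \<beta> * h" by (auto simp: multiples_def)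
    have "G_product G \<alpha> * T = G_product G (\<lambda>g. \<alpha> g + \<beta> g) * h"
      by (simp add: T(2) G_product_add[symmetric] mult.assoc)
    then have "G_product G \<alpha> * T \<in> multiples H G" using multiplesI[OF T(1)] by simp
    moreover have "Fin (int 0) \<le> val i (G_product G \<alpha> * T)" for i
      using multiple(2) G_product_in_O_bar[of \<alpha>]
      by (intro le_val_mult_right) (auto simp: O_bar_iff)
    ultimately show ?case by (rule mspan_multiple)
  next
    case (add a b)
    then show ?case by (simp add: distrib_left mspan_add)
  next
    case (smult c a)
    have "G_product G \<alpha> * (fls_const c *s a) = fls_const c *s (G_product G \<alpha> * a)"
      by (simp add: vec_eq_iff)
    then show ?case using smult by (simp add: mspan_smult)
  next
    case (tail z)
    with G_product_in_O_bar show ?case by (rule mult_tail)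
  next
    case zero
    then show ?case by (auto intro: mspan_tail)
  qed
  from u show ?thesis
  proof (induction rule: mspan_induct)
    case zero
    then show ?case by (auto intro: mspan_tail)
  next
    case (add a b)
    then show ?case by (simp add: distrib_right mspan_add)
  next
    case (smult c a)
    have "(fls_const c *s a) * w = fls_const c *s (a * w)" by (simp add: vec_eq_iff)
    then show ?case using smult by (simp add: mspan_smult)
  next
    case (multiple T)
    then show ?case using G_product by (auto simp: multiples_def)
  next
    case (tail z)
    then show ?case using mult_tail[OF mspan_O_bar[OF w], of z] by (simp add: mult.commute)
  qed
qed

text \<open>The Leibniz rule, applied factor by factor. \<open>Q\<close> also tracks
  \<open>w\<close> itself, because the rule multiplies derivatives by undifferentiated
  factors.\<close>

lemma t_deriv_G_product: "t_deriv (G_product G \<alpha>) \<in> mspan (t_deriv ` G) (\<lambda>_. 0) N"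
proof -
  define Q where "Q w \<longleftrightarrow> w \<in> mspan {1} (\<lambda>_. 0) N \<and> t_deriv w \<in> mspan (t_deriv ` G) (\<lambda>_. 0) N" for w
  have mult: "Q (u * w)" if "Q u" "Q w" for u w
    using that by (auto simp: Q_def t_deriv_mult intro: mspan_mult mspan_add)
  have product_in: "G_product G \<beta> \<in> mspan {1} (\<lambda>_. 0) N" for \<beta>
    using multiplesI[of 1 "{1}" G \<beta>] R_val[OF R_G_product] by (intro mspan_multiple) auto
  have one: "Q 1"
    using product_in[of "\<lambda>_. 0"] by (auto simp: Q_def intro: mspan_tail)
  have g: "Q g" if "g \<in> G" for g
  proof -
    have "t_deriv g \<in> multiples (t_deriv ` G) G" using that subset_multiples by blast
    moreover have "Fin (int 0) \<le> val i (t_deriv g)" for i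
      using that G_R R_val[of g i] by (auto intro: le_val_t_deriv)
    ultimately have "t_deriv g \<in> mspan (t_deriv ` G) (\<lambda>_. 0) N" by (rule mspan_multiple)
    then show ?thesis using product_in G_product_single[OF that] unfolding Q_def by metis
  qed
  have pow: "Q (g ^ n)" if "g \<in> G" for g n
    by (induction n) (auto intro: one mult g that)
  have "Q (\<Prod>g\<in>A. g ^ \<alpha> g)" if "finite A" "A \<subseteq> G" for A
    using that by (induction A rule: finite_induct) (auto intro: one mult pow)
  then show ?thesis using finite_G by (simp add: G_product_def Q_def)
qed

text \<open>\<open>t_deriv\<close> is linear and preserves tails, so it carries approximations of
  elements of \<open>R\<close> by \<open>G\<close>-products to approximations of their
  differentials.\<close>

lemma M_approx:
  assumes N: "\<And>i. \<sigma> i \<le> N" and u: "u \<in> M"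
  shows "u \<in> mspan (t_deriv ` G) (\<lambda>_. 0) N"
proof -
  have t_deriv: "t_deriv w \<in> mspan (t_deriv ` G) (\<lambda>_. 0) N" if "w \<in> R" for w
    using R_approx[OF N that]
  proof (induction rule: mspan_induct)
    case zero
    then show ?case by (auto intro: mspan_tail)
  next
    case (multiple T)
    then show ?case using t_deriv_G_product by (auto simp: multiples_def)
  qed (auto simp: t_deriv_add t_deriv_smult intro: mspan_add mspan_smult mspan_tail le_val_t_deriv)
  from u show ?thesis
    by (rule M_E) (auto intro!: mspan_add mspan_mult R_approx N t_deriv R_xy)
qed


subsection \<open>Executions\<close>

text \<open>The invariant of executions. Retaining the initial set keeps available both the
  approximation of \<open>M\<close> and the multiples living on one branch.\<close>

definition admissible :: "('a fls ^ 'i) set \<Rightarrow> bool" where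
  "admissible H \<longleftrightarrow> finite H \<and> t_deriv ` G \<subseteq> H \<and> H \<subseteq> M - {0}"

lemma admissible_O_bar: "admissible H \<Longrightarrow> finite H \<and> H \<subseteq> O_bar"
  using M_O_bar by (auto simp: admissible_def)

lemma admissible_initial: "admissible (t_deriv ` G)"
proof -
  have "t_deriv g \<noteq> 0" if g: "g \<in> G" for g
  proof
    assume "t_deriv g = 0"
    then have "val i g = Pinf" for i using val_t_deriv[OF val_G[OF g], of i] by simp
    then show False using g G_nonzero val_eq_vec_zero by metis
  qed
  then show ?thesis using finite_G M_t_deriv_G by (auto simp: admissible_def)
qed

lemma admissible_iteration:
  assumes H: "admissible H" and iter: "iteration G \<sigma> H H'"
  shows "admissible H'"
proof -
  obtain S \<rho> where S: "S \<subseteq> relevant_S_processes H G \<sigma>"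
    "\<And>\<omega>. \<omega> \<in> S \<Longrightarrow> final_reduction H G \<omega> (\<rho> \<omega>)" "H' = H \<union> {\<rho> \<omega> | \<omega>. \<omega> \<in> S \<and> \<rho> \<omega> \<noteq> 0}"
    using iter unfolding iteration_def scalar_representatives_def by blast
  have HM: "H \<subseteq> M" using H by (auto simp: admissible_def)
  have "\<rho> \<omega> \<in> M" if "\<omega> \<in> S" for \<omega>
  proof -
    have "\<omega> \<in> relevant_S_processes H G \<sigma>" using that S(1) by blast
    then have "\<omega> \<in> M" using multiples_M[OF HM]
      by (auto simp: relevant_S_processes_def S_process_def intro!: M_add M_smult dest: multiplesI)
    then show ?thesis using final_reduction_M[OF S(2)[OF that]] HM by blast
  qed
  moreover have "finite H'" using iteration_finite[OF iter] admissible_O_bar[OF H] by blast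
  ultimately show ?thesis using H S(3) by (auto simp: admissible_def)
qed

lemma iteration_mono: "iteration G \<sigma> H H' \<Longrightarrow> H \<subseteq> H'"
  by (auto simp: iteration_def)

lemma fixpoint_standard_basis:
  assumes H: "admissible H" and fixpoint: "iteration G \<sigma> H H"
  shows "standard_basis H G M"
  unfolding standard_basis_def
proof (intro conjI ballI impI)
  show "finite H" "H \<subseteq> M - {0}" using H by (auto simp: admissible_def)
  fix u assume u: "u \<in> M" "u \<noteq> 0"
  have init: "t_deriv ` G \<subseteq> H" using H by (simp add: admissible_def)
  define N0 where "N0 = Max (range \<sigma>)"
  have N0: "\<sigma> i \<le> N" if "N0 \<le> N" for i N
    using that Max_ge[of "range \<sigma>" "\<sigma> i"] by (simp add: N0_def)
  show "\<exists>u'. reduction H G u u'"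
  proof (rule reducible_of_mspan)
    show "u \<in> O_bar" "u \<noteq> 0" using u M_O_bar by auto
    show "u \<in> mspan H (\<lambda>_. 0) N" if "N0 \<le> N" for N
      using M_approx[OF N0[OF that] u(1)] mspan_mono[OF init, of "\<lambda>_. 0" "\<lambda>_. 0"] by blast
    fix N \<gamma> k s
    assume s: "S_process H G k s" "\<And>i. Fin (int (\<gamma> i)) \<le> val i s"
    show "s \<in> mspan H \<gamma> N"
    proof (rule fixpoint_S_process_in_mspan[OF fixpoint _ _ s])
      show "\<exists>T\<in>multiples H G. val k T = Fin (int n) \<and> (\<forall>i. i \<noteq> k \<longrightarrow> T $ i = 0)"
        if "max (\<sigma> k) 1 \<le> n" for k n
        using single_multiple[OF that] multiples_mono[OF init] by (metis subsetD)
      show "Fin 1 \<le> val i h" if "h \<in> H" for h i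
        using that H M_val by (auto simp: admissible_def)
    qed
  qed (use admissible_O_bar[OF H] in auto)
qed

text \<open>
  A new element is irreducible, so each of its values is infinite or below \<open>max (\<sigma> k) 1\<close>, and its
  vector of values differs from that of every earlier element.
\<close>

lemma no_infinite_execution:
  assumes init: "Hs 0 = t_deriv ` G"
    and step: "\<And>j. iteration G \<sigma> (Hs j) (Hs (Suc j))" "\<And>j. Hs (Suc j) \<noteq> Hs j"
  shows False
proof -
  have adm: "admissible (Hs j)" for j
    by (induction j) (auto simp: init intro: admissible_initial admissible_iteration step)
  have mono: "Hs j \<subseteq> Hs l" if "j \<le> l" for j l
    using lift_Suc_mono_le[of Hs] iteration_mono[OF step(1)] that by blast
  have "\<exists>u. u \<in> Hs (Suc j) \<and> u \<noteq> 0 \<and> \<not> (\<exists>u'. reduction (Hs j) G u u')" for j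
  proof -
    obtain S \<rho> where S: "\<And>\<omega>. \<omega> \<in> S \<Longrightarrow> final_reduction (Hs j) G \<omega> (\<rho> \<omega>)"
      "Hs (Suc j) = Hs j \<union> {\<rho> \<omega> | \<omega>. \<omega> \<in> S \<and> \<rho> \<omega> \<noteq> 0}"
      using step(1)[of j] unfolding iteration_def by blast
    then obtain \<omega> where \<omega>: "\<omega> \<in> S" "\<rho> \<omega> \<noteq> 0" using step(2)[of j] by blast
    moreover have "\<not> (\<exists>u'. reduction (Hs j) G (\<rho> \<omega>) u')"
      using S(1)[OF \<omega>(1)] by (simp add: final_reduction_def)
    ultimately show ?thesis using S(2) by blast
  qed
  then obtain u where u: "\<And>j. u j \<in> Hs (Suc j)" "\<And>j. u j \<noteq> 0"
    "\<And>j. \<not> (\<exists>u'. reduction (Hs j) G (u j) u')"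
    by metis
  have irred: False if "T \<in> multiples (Hs j) G" "val k (u j) \<noteq> Pinf" "val k T = val k (u j)"
    "\<And>i. val i (u j) \<le> val i T" for j k T
    using u(3)[of j] that unfolding reducible_iff by blast
  define s where "s = Max (range (\<lambda>i. int (max (\<sigma> i) 1)))"
  have s: "int (max (\<sigma> i) 1) \<le> s" for i unfolding s_def by (intro Max_ge) auto
  define V where "V = insert Pinf (Fin ` {0..s})"
  have "val k (u j) \<in> V" for j k
  proof (cases "val k (u j) = Pinf")
    case True
    then show ?thesis by (simp add: V_def)
  next
    case False
    then obtain n where n: "val k (u j) = Fin n" by (rule val_neq_PinfE)
    have "u j \<in> M" using u(1)[of j] adm[of "Suc j"] by (auto simp: admissible_def)
    from M_val[OF this, of k] have "1 \<le> n" using n by simp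
    moreover have "n \<le> s"
    proof (rule ccontr)
      assume "\<not> n \<le> s"
      then have "max (\<sigma> k) 1 \<le> nat n" using s[of k] by linarith
      \<comment> \<open>Since \<open>T\<close> vanishes away from \<open>k\<close>, equality of the
        values at \<open>k\<close> is enough for it to reduce \<open>u j\<close>.\<close>
      then obtain T where T: "T \<in> multiples (t_deriv ` G) G" "val k T = Fin (int (nat n))"
        "\<And>i. i \<noteq> k \<Longrightarrow> T $ i = 0"
        by (rule single_multiple) blast
      have Tk: "val k T = val k (u j)" using T(2) n \<open>1 \<le> n\<close> by simp
      have "val i (u j) \<le> val i T" for i
      proof (cases "i = k")
        case False
        then have "val i T = Pinf" using T(3) by (simp add: val_eq_Pinf_iff)
        then show ?thesis by simp
      qed (simp add: Tk)
      moreover have "T \<in> multiples (Hs j) G"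
        using T(1) multiples_mono[of "t_deriv ` G" "Hs j" G] adm[of j] by (auto simp: admissible_def)
      ultimately show False using irred[of T j k] False Tk by blast
    qed
    ultimately show ?thesis using n by (simp add: V_def)
  qed
  then have "range (\<lambda>j i. val i (u j)) \<subseteq> {w. \<forall>i. w i \<in> V}" by auto
  moreover have "finite {w :: 'i \<Rightarrow> int extended. \<forall>i. w i \<in> V}"
    using finite_PiE[of "UNIV :: 'i set" "\<lambda>_. V"] by (simp add: V_def PiE_def Pi_def)
  ultimately have "finite (range (\<lambda>j i. val i (u j)))" by (rule finite_subset)
  then have "\<not> inj (\<lambda>j i. val i (u j))" using finite_imageD infinite_UNIV_nat by blast
  then obtain j l where "j < l" and eq: "(\<lambda>i. val i (u j)) = (\<lambda>i. val i (u l))"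
    using linorder_injI[of "\<lambda>j i. val i (u j)"] by blast
  \<comment> \<open>The earlier element belongs to the later set and, having the same values, would
    reduce \<open>u l\<close>.\<close>
  have "u j \<in> multiples (Hs l) G"
    using u(1)[of j] mono[of "Suc j" l] \<open>j < l\<close> subset_multiples by fastforce
  moreover obtain k where "val k (u l) \<noteq> Pinf" using u(2)[of l] val_eq_vec_zero by blast
  ultimately show False using irred[of "u j" l k] eq by (simp add: fun_eq_iff)
qed

end


subsection \<open>Plane curves\<close>

text \<open>This map and \<open>pull_back\<close> act on representatives; \<open>emb\<close> and
  \<open>phi_star\<close> are the maps they induce on classes.\<close>

definition curve_map ::
  "('i::finite \<Rightarrow> 'a::field fps \<times> 'a fps) \<Rightarrow> 'a fps fps \<Rightarrow> 'a fls ^ 'i" where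
  "curve_map \<phi> p = (\<chi> i. fps_to_fls (subst2 p (\<phi> i)))"

definition pull_back ::
  "('i::finite \<Rightarrow> 'a::field fps \<times> 'a fps) \<Rightarrow> 'a fps fps \<times> 'a fps fps \<Rightarrow> 'a fls ^ 'i" where
  "pull_back \<phi> = (\<lambda>(p, q). \<chi> i. fps_to_fls (fps_X *
     (subst2 p (\<phi> i) * fps_deriv (fst (\<phi> i)) + subst2 q (\<phi> i) * fps_deriv (snd (\<phi> i)))))"

lemma the_elem_image_const:
  assumes "x \<in> A" "\<And>y. y \<in> A \<Longrightarrow> h y = c"
  shows "the_elem (h ` A) = c"
proof -
  have "h ` A = {c}" using assms by auto
  then show ?thesis by simp
qed

locale plane_curve =
  fixes f :: "'i::finite \<Rightarrow> 'a::field_char_0 fps fps" and F and \<phi> :: "'i \<Rightarrow> 'a fps \<times> 'a fps"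
  assumes irreducible: "\<And>i. irreducible (f i)"
    and distinct: "\<And>i j. i \<noteq> j \<Longrightarrow> {g. f i dvd g} \<noteq> {g. f j dvd g}"
    and curve: "F = (\<Prod>i\<in>UNIV. f i)"
    and branches: "\<And>i. parameterization (f i) (\<phi> i)"
begin

lemma \<phi>_0: "fps_nth (fst (\<phi> i)) 0 = 0" "fps_nth (snd (\<phi> i)) 0 = 0"
  using branches[of i] by (simp_all add: parameterization_def)

lemma subst2_eq_0_iff: "subst2 p (\<phi> i) = 0 \<longleftrightarrow> f i dvd p"
  using branches[of i] by (simp add: parameterization_def)

lemma subst2_mult_\<phi>: "subst2 (p * q) (\<phi> i) = subst2 p (\<phi> i) * subst2 q (\<phi> i)"
  using subst2_mult[OF \<phi>_0, of p q i i] by simp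

lemma curve_map_add: "curve_map \<phi> (p + q) = curve_map \<phi> p + curve_map \<phi> q"
  by (simp add: curve_map_def vec_eq_iff subst2_add)

lemma curve_map_diff: "curve_map \<phi> (p - q) = curve_map \<phi> p - curve_map \<phi> q"
  by (simp add: curve_map_def vec_eq_iff subst2_diff)

lemma curve_map_mult: "curve_map \<phi> (p * q) = curve_map \<phi> p * curve_map \<phi> q"
  by (simp add: curve_map_def vec_eq_iff subst2_mult_\<phi> fls_times_fps_to_fls)

lemma curve_map_const: "curve_map \<phi> (fps_const (fps_const c)) = fls_const c *s 1"
proof -
  have "subst2 (fps_const (fps_const c)) (\<phi> i) = fps_const c" for i
    using subst2_const[of "fps_const c" "fst (\<phi> i)" "snd (\<phi> i)"] by simp
  then show ?thesis by (simp add: curve_map_def vec_eq_iff)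
qed

lemma curve_map_one: "curve_map \<phi> 1 = 1"
  using curve_map_const[of 1] by simp

lemma curve_map_coords:
  "curve_map \<phi> (fps_const fps_X) = (\<chi> i. fps_to_fls (fst (\<phi> i)))"
  "curve_map \<phi> fps_X = (\<chi> i. fps_to_fls (snd (\<phi> i)))"
proof -
  have "subst2 (fps_const fps_X) (\<phi> i) = fst (\<phi> i)" "subst2 fps_X (\<phi> i) = snd (\<phi> i)" for i
    using subst2_const[of fps_X "fst (\<phi> i)" "snd (\<phi> i)"]
      subst2_fps_X[OF \<phi>_0(2), of "fst (\<phi> i)" i] \<phi>_0(1)[of i]
    by (simp_all add: fps_X_fps_compose_startby0)
  then show "curve_map \<phi> (fps_const fps_X) = (\<chi> i. fps_to_fls (fst (\<phi> i)))"
    "curve_map \<phi> fps_X = (\<chi> i. fps_to_fls (snd (\<phi> i)))"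
    by (simp_all add: curve_map_def)
qed

text \<open>Substitution is a homomorphism into a domain whose kernel is generated by
  \<open>f i\<close>, so \<open>f i\<close> is prime.\<close>

lemma f_dvd_mult: "f i dvd p * q \<longleftrightarrow> f i dvd p \<or> f i dvd q"
  by (simp flip: subst2_eq_0_iff add: subst2_mult_\<phi>)

text \<open>The cofactor of one irreducible dividing another is a unit, which would make the two
  ideals equal.\<close>

lemma f_not_dvd: "\<not> f i dvd f j" if "i \<noteq> j"
proof
  assume "f i dvd f j"
  then obtain u where u: "f j = f i * u" by (auto elim: dvdE)
  then have "u dvd 1" using irreducible[of i] irreducible[of j]
    by (metis irreducible_def)
  then obtain v where v: "1 = u * v" by (auto elim: dvdE)
  have "f i = f j * v" unfolding u mult.assoc v[symmetric] by simp
  with u have "f i dvd g \<longleftrightarrow> f j dvd g" for g by (metis dvd_mult_left)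
  then show False using distinct[OF that] by simp
qed

text \<open>The factors are primes not dividing one another, so they can be split off one at a time.
  This yields injectivity of the local ring into Q.\<close>

lemma F_dvd_iff: "F dvd p \<longleftrightarrow> (\<forall>i. f i dvd p)"
proof
  assume "F dvd p"
  then show "\<forall>i. f i dvd p" unfolding curve by (meson dvd_prodI dvd_trans finite UNIV_I)
next
  assume p: "\<forall>i. f i dvd p"
  have "(\<Prod>i\<in>A. f i) dvd p" if "finite A" for A :: "'i set"
    using that
  proof (induction A rule: finite_induct)
    case (insert j A)
    then obtain q where q: "p = (\<Prod>i\<in>A. f i) * q" by (auto elim: dvdE)
    have "\<not> f j dvd (\<Prod>i\<in>B. f i)" if "finite B" "j \<notin> B" for B
      using that
    proof (induction B rule: finite_induct)
      case empty
      then show ?case using irreducible[of j] by (auto simp: irreducible_def)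
    next
      case (insert i B)
      then show ?case using f_not_dvd[of j i] by (auto simp: f_dvd_mult)
    qed
    then have "f j dvd q" using p insert.hyps q f_dvd_mult by metis
    then show ?case using q insert.hyps by (auto intro: mult_dvd_mono simp: mult.commute)
  qed simp
  then show "F dvd p" by (simp add: curve)
qed

lemma curve_map_eq_iff: "curve_map \<phi> p = curve_map \<phi> q \<longleftrightarrow> F dvd p - q"
proof -
  have "curve_map \<phi> p = curve_map \<phi> q \<longleftrightarrow> (\<forall>i. subst2 (p - q) (\<phi> i) = 0)"
    by (simp add: curve_map_def vec_eq_iff subst2_diff)
  then show ?thesis by (simp add: subst2_eq_0_iff F_dvd_iff)
qed

lemma emb_cls: "emb \<phi> (cls F p) = curve_map \<phi> p"
  unfolding emb_def
proof (rule the_elem_image_const)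
  show "p \<in> cls F p" by (simp add: cls_def ring_rel_def)
  fix q assume "q \<in> cls F p"
  then have "F dvd p - q" by (simp add: cls_def ring_rel_def)
  then have "curve_map \<phi> q = curve_map \<phi> p" by (simp flip: curve_map_eq_iff)
  then show "(\<chi> i. fps_to_fls (subst2 q (\<phi> i))) = curve_map \<phi> p" by (simp add: curve_map_def)
qed

lemma emb_local_ring: "emb \<phi> ` local_ring F = range (curve_map \<phi>)"
proof -
  have "local_ring F = range (cls F)"
    by (auto simp: local_ring_def quotient_def cls_def)
  then show ?thesis by (simp add: image_image emb_cls)
qed

lemma pull_back_eq:
  "pull_back \<phi> (p, q) = curve_map \<phi> p * t_deriv (curve_map \<phi> (fps_const fps_X)) +
    curve_map \<phi> q * t_deriv (curve_map \<phi> fps_X)"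
  unfolding curve_map_coords
  by (simp add: pull_back_def curve_map_def t_deriv_def vec_eq_iff fls_times_fps_to_fls
      fls_deriv_fps_to_fls algebra_simps)

lemma t_deriv_curve_map: "t_deriv (curve_map \<phi> p) = pull_back \<phi> (deriv_X p, deriv_Y p)"
proof -
  have "fps_deriv (subst2 p (\<phi> i)) = subst2 (deriv_X p) (\<phi> i) * fps_deriv (fst (\<phi> i)) +
      subst2 (deriv_Y p) (\<phi> i) * fps_deriv (snd (\<phi> i))" for i
    using fps_deriv_subst2[OF \<phi>_0, of p i i] by simp
  then show ?thesis
    by (simp add: pull_back_def curve_map_def t_deriv_def vec_eq_iff fls_times_fps_to_fls
        fls_deriv_fps_to_fls)
qed

text \<open>Both kinds of relation die: \<open>F\<close> maps to 0, and by the chain rule the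
  differential of \<open>F\<close> maps to \<open>t_deriv\<close> of that 0.\<close>

lemma pull_back_cong:
  assumes "((p, q), (p', q')) \<in> omega_rel F"
  shows "pull_back \<phi> (p', q') = pull_back \<phi> (p, q)"
proof -
  from assms obtain a b c where abc: "p - p' = a * deriv_X F + b * F" "q - q' = a * deriv_Y F + c * F"
    by (auto simp: omega_rel_def)
  have F0: "curve_map \<phi> F = 0"
    using curve_map_eq_iff[of F 0] curve_map_diff[of 0 0] by simp
  let ?x = "t_deriv (curve_map \<phi> (fps_const fps_X))" and ?y = "t_deriv (curve_map \<phi> fps_X)"
  have "pull_back \<phi> (p, q) - pull_back \<phi> (p', q') =
      curve_map \<phi> (p - p') * ?x + curve_map \<phi> (q - q') * ?y"
    by (simp add: pull_back_eq curve_map_diff algebra_simps)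
  also have "\<dots> = curve_map \<phi> a * pull_back \<phi> (deriv_X F, deriv_Y F)"
    by (simp add: abc curve_map_add curve_map_mult F0 pull_back_eq algebra_simps)
  also have "\<dots> = 0" by (simp add: F0 flip: t_deriv_curve_map)
  finally show ?thesis by simp
qed

lemma phi_star_eq:
  assumes "(p, q) \<in> w" "\<And>p' q'. (p', q') \<in> w \<Longrightarrow> pull_back \<phi> (p', q') = pull_back \<phi> (p, q)"
  shows "phi_star \<phi> w = pull_back \<phi> (p, q)"
  unfolding phi_star_def pull_back_def[symmetric]
  using assms(1) by (rule the_elem_image_const) (use assms(2) in auto)

lemma omega_rel_refl: "((p, q), (p, q)) \<in> omega_rel F"
  unfolding omega_rel_def by (auto intro!: exI[of _ 0])

lemma phi_star_Omega: "phi_star \<phi> ` Omega F = range (pull_back \<phi>)"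
proof -
  have "phi_star \<phi> (omega_rel F `` {w}) = pull_back \<phi> w" for w
    by (cases w) (auto intro!: phi_star_eq omega_rel_refl pull_back_cong)
  moreover have "Omega F = range (\<lambda>w. omega_rel F `` {w})"
    by (auto simp: Omega_def quotient_def)
  ultimately show ?thesis by (simp add: image_image)
qed

lemma phi_star_differential: "phi_star \<phi> (differential F (cls F p)) = t_deriv (curve_map \<phi> p)"
  unfolding t_deriv_curve_map
proof (rule phi_star_eq)
  have "p \<in> cls F p" by (simp add: cls_def ring_rel_def)
  then show "(deriv_X p, deriv_Y p) \<in> differential F (cls F p)"
    using omega_rel_refl[of "deriv_X p" "deriv_Y p"] by (auto simp: differential_def)
  fix a b assume "(a, b) \<in> differential F (cls F p)"
  then obtain p' where p': "p' \<in> cls F p" and ab: "((deriv_X p', deriv_Y p'), (a, b)) \<in> omega_rel F"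
    by (auto simp: differential_def)
  have "curve_map \<phi> p' = curve_map \<phi> p"
    using p' curve_map_eq_iff[of p p'] by (simp add: cls_def ring_rel_def)
  then have "pull_back \<phi> (deriv_X p', deriv_Y p') = pull_back \<phi> (deriv_X p, deriv_Y p)"
    by (simp flip: t_deriv_curve_map)
  with pull_back_cong[OF ab] show "pull_back \<phi> (a, b) = pull_back \<phi> (deriv_X p, deriv_Y p)" by simp
qed

text \<open>Splitting off the powers of \<open>t\<close> shows that \<open>z\<close> lies in the
  conductor ideal. Multiplying by 1 then places it in the ring.\<close>

lemma in_conductor:
  assumes "conductor F \<phi> \<sigma>" and z: "\<And>i. Fin (int (\<sigma> i)) \<le> val i z"
  shows "z \<in> range (curve_map \<phi>)"
proof -
  define b where "b = (\<chi> i. fls_shift (int (\<sigma> i)) (z $ i))"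
  define s where "s = ((\<chi> i. fls_X ^ \<sigma> i) :: 'a fls ^ 'i)"
  have s: "val i s = Fin (int (\<sigma> i))" for i by (simp add: s_def val_def)
  have zb: "z = s * b" by (simp add: b_def s_def vec_eq_iff fls_X_power_times_conv_shift)
  have "Fin 0 \<le> val i b" for i
    using z[of i] s[of i] unfolding zb val_mult by (cases "val i b") auto
  then have "b \<in> O_bar" by (simp add: O_bar_iff)
  then have "z \<in> {h. \<forall>b\<in>O_bar. h * b \<in> emb \<phi> ` local_ring F}"
    using assms(1) zb unfolding conductor_def s_def by blast
  moreover have "1 \<in> O_bar" by (simp add: O_bar_iff zero_extended_def)
  ultimately have "z * 1 \<in> emb \<phi> ` local_ring F" by blast
  then show ?thesis by (simp add: emb_local_ring)
qed

lemma curve_ring: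
  assumes "conductor F \<phi> \<sigma>" and basis: "ring_standard_basis F \<phi> G"
  shows "curve_ring (emb \<phi> ` G) (range (curve_map \<phi>)) \<sigma>
    (curve_map \<phi> (fps_const fps_X)) (curve_map \<phi> fps_X)"
proof -
  \<comment> \<open>Representatives without constant term give positive values, and injectivity of
    the embedding keeps nonzero classes nonzero.\<close>
  have G: "\<exists>p. u = curve_map \<phi> p \<and> fps_nth (fps_nth p 0) 0 = 0 \<and> curve_map \<phi> p \<noteq> 0"
    if "u \<in> emb \<phi> ` G" for u
  proof -
    from that obtain g where g: "g \<in> G" "u = emb \<phi> g" by blast
    moreover have "G \<subseteq> max_ideal F - {cls F 0}" using basis by (simp add: ring_standard_basis_def)
    ultimately obtain p where p: "g = cls F p" "fps_nth (fps_nth p 0) 0 = 0" "g \<noteq> cls F 0"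
      unfolding max_ideal_def by blast
    have "curve_map \<phi> p \<noteq> 0"
    proof
      assume "curve_map \<phi> p = 0"
      then have "curve_map \<phi> p = curve_map \<phi> q \<longleftrightarrow> curve_map \<phi> 0 = curve_map \<phi> q" for q
        using curve_map_diff[of 0 0] by simp
      then have "cls F p = cls F 0"
        unfolding curve_map_eq_iff by (simp add: cls_def ring_rel_def Image_def)
      with p show False by simp
    qed
    with p g show ?thesis by (auto simp: emb_cls)
  qed
  show ?thesis
  proof
  show "finite (emb \<phi> ` G)" using basis by (simp add: ring_standard_basis_def)
  show "Fin 1 \<le> val i u" if "u \<in> emb \<phi> ` G" for u i
  proof -
    from G[OF that] obtain p where "u = curve_map \<phi> p" "fps_nth (fps_nth p 0) 0 = 0" by blast
    then show ?thesis
      by (auto simp: curve_map_def Fin_le_val_iff subst2_nth_0)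
  qed
  show "range (curve_map \<phi>) \<subseteq> O_bar"
    by (auto simp: O_bar_def curve_map_def)
  show "1 \<in> range (curve_map \<phi>)" using curve_map_one by (metis rangeI)
  fix u w assume "u \<in> range (curve_map \<phi>)"
  then obtain p where p: "u = curve_map \<phi> p" by blast
  show "fls_const c *s u \<in> range (curve_map \<phi>)" for c
  proof -
    have "fls_const c *s u = curve_map \<phi> (fps_const (fps_const c) * p)"
      by (simp add: p curve_map_mult curve_map_const vec_eq_iff)
    then show ?thesis by simp
  qed
  show "\<exists>u'. reduction {1} (emb \<phi> ` G) u u'" if "u \<noteq> 0"
    using basis that p by (simp add: ring_standard_basis_def emb_local_ring)
  assume "w \<in> range (curve_map \<phi>)"
  then obtain q where q: "w = curve_map \<phi> q" by blast
  show "u + w \<in> range (curve_map \<phi>)" unfolding p q curve_map_add[symmetric] by simp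
  show "u * w \<in> range (curve_map \<phi>)" unfolding p q curve_map_mult[symmetric] by simp
next
  show "emb \<phi> ` G \<subseteq> range (curve_map \<phi>)"
  proof
    fix u assume "u \<in> emb \<phi> ` G"
    from G[OF this] obtain p where "u = curve_map \<phi> p" by blast
    then show "u \<in> range (curve_map \<phi>)" by simp
  qed
  show "0 \<notin> emb \<phi> ` G" using G[of 0] by metis
  show "curve_map \<phi> (fps_const fps_X) \<in> range (curve_map \<phi>)" "curve_map \<phi> fps_X \<in> range (curve_map \<phi>)"
    by simp_all
  show "z \<in> range (curve_map \<phi>)" if "\<And>i. Fin (int (\<sigma> i)) \<le> val i z" for z
    using assms(1) that by (rule in_conductor)
  show "\<exists>p\<in>range (curve_map \<phi>). \<exists>q\<in>range (curve_map \<phi>). t_deriv g =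
      p * t_deriv (curve_map \<phi> (fps_const fps_X)) + q * t_deriv (curve_map \<phi> fps_X)"
    if "g \<in> emb \<phi> ` G" for g
  proof -
    from G[OF that] obtain p where g: "g = curve_map \<phi> p" by blast
    have "t_deriv g = curve_map \<phi> (deriv_X p) * t_deriv (curve_map \<phi> (fps_const fps_X)) +
        curve_map \<phi> (deriv_Y p) * t_deriv (curve_map \<phi> fps_X)"
      unfolding g t_deriv_curve_map[of p] by (rule pull_back_eq)
    then show ?thesis by blast
  qed
  qed
qed

end

text \<open>The first conjunct says that a run is never stuck, so excluding infinite runs really
  means stopping. With a single branch the class of \<open>f i\<close> is zero and cannot lie in
  \<open>G\<close>, hence the removal of \<open>cls F 0\<close>.\<close>

theorem proposition19:
  fixes f :: "'i::finite \<Rightarrow> 'a::{alg_closed_field, field_char_0} fps fps"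
    and F :: "'a fps fps"
    and \<phi> :: "'i \<Rightarrow> 'a fps \<times> 'a fps"
    and \<sigma> :: "'i \<Rightarrow> nat"
    and G :: "'a fps fps set set"
  assumes irreducible: "\<And>i. irreducible (f i)"
    and distinct: "\<And>i j. i \<noteq> j \<Longrightarrow> {g. f i dvd g} \<noteq> {g. f j dvd g}"
    and curve: "F = (\<Prod>i\<in>UNIV. f i)"
    and branches: "\<And>i. parameterization (f i) (\<phi> i)"
    and conductor: "conductor F \<phi> \<sigma>"
    and basis: "ring_standard_basis F \<phi> G"
    and contains_branches: "{cls F (f i) | i. True} - {cls F 0} \<subseteq> G"
  shows
    "(\<forall>n Hs. execution F \<phi> \<sigma> G n Hs \<longrightarrow> (\<exists>H'. iteration (emb \<phi> ` G) \<sigma> (Hs n) H')) \<and>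
     (\<nexists>Hs. \<forall>n. execution F \<phi> \<sigma> G n Hs) \<and>
     (\<forall>n Hs. execution F \<phi> \<sigma> G n Hs \<and> iteration (emb \<phi> ` G) \<sigma> (Hs n) (Hs n) \<longrightarrow>
        standard_basis (Hs n) (emb \<phi> ` G) (phi_star \<phi> ` Omega F))"
proof -
  interpret plane_curve f F \<phi>
    using irreducible distinct curve branches by (rule plane_curve.intro)
  interpret curve_ring "emb \<phi> ` G" "range (curve_map \<phi>)" \<sigma>
    "curve_map \<phi> (fps_const fps_X)" "curve_map \<phi> fps_X"
    using conductor basis by (rule curve_ring)
  have init: "initial_set F \<phi> G = t_deriv ` emb \<phi> ` G"
    unfolding initial_set_def image_image
  proof (rule image_cong)
    fix g assume "g \<in> G"
    then obtain p where "g = cls F p"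
      using basis by (auto simp: ring_standard_basis_def max_ideal_def)
    then show "phi_star \<phi> (differential F g) = t_deriv (emb \<phi> g)"
      by (simp add: phi_star_differential emb_cls)
  qed simp
  have M_eq: "phi_star \<phi> ` Omega F = M"
    unfolding phi_star_Omega
  proof (intro equalityI subsetI)
    fix w assume "w \<in> range (pull_back \<phi>)"
    then obtain p q where "w = pull_back \<phi> (p, q)" by auto
    then show "w \<in> M" using M_I[of "curve_map \<phi> p" "curve_map \<phi> q"] by (simp add: pull_back_eq)
  next
    fix w assume "w \<in> M"
    then obtain p q where "w = pull_back \<phi> (p, q)" by (auto simp: pull_back_eq elim!: M_E)
    then show "w \<in> range (pull_back \<phi>)" by simp
  qed
  have adm: "admissible (Hs n)" if "execution F \<phi> \<sigma> G n Hs" for n Hs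
  proof -
    have "admissible (Hs j)" if "j \<le> n" for j
      using that
    proof (induction j)
      case 0
      then show ?case
        using \<open>execution F \<phi> \<sigma> G n Hs\<close> admissible_initial by (simp add: execution_def init)
    next
      case (Suc j)
      then show ?case
        using \<open>execution F \<phi> \<sigma> G n Hs\<close> admissible_iteration[of "Hs j"] by (simp add: execution_def)
    qed
    then show ?thesis by simp
  qed
  show ?thesis
  proof (intro conjI allI impI notI)
    fix n Hs assume "execution F \<phi> \<sigma> G n Hs"
    then have "finite (Hs n)" "Hs n \<subseteq> O_bar" using admissible_O_bar[OF adm] by simp_all
    then obtain H' where "iteration (emb \<phi> ` G) \<sigma> (Hs n) H'" by (rule iteration_exists)
    then show "\<exists>H'. iteration (emb \<phi> ` G) \<sigma> (Hs n) H'" by (rule exI)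
  next
    assume "\<exists>Hs. \<forall>n. execution F \<phi> \<sigma> G n Hs"
    then obtain Hs where Hs: "execution F \<phi> \<sigma> G n Hs" for n by blast
    have "Hs 0 = t_deriv ` emb \<phi> ` G" using Hs[of 0] by (simp add: execution_def init)
    moreover have "iteration (emb \<phi> ` G) \<sigma> (Hs j) (Hs (Suc j))" "Hs (Suc j) \<noteq> Hs j" for j
      using Hs[of "Suc j"] by (simp_all add: execution_def)
    ultimately show False by (rule no_infinite_execution)
  next
    fix n Hs
    assume run: "execution F \<phi> \<sigma> G n Hs \<and> iteration (emb \<phi> ` G) \<sigma> (Hs n) (Hs n)"
    show "standard_basis (Hs n) (emb \<phi> ` G) (phi_star \<phi> ` Omega F)"
      unfolding M_eq using adm[OF conjunct1[OF run]] conjunct2[OF run]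
      by (rule fixpoint_standard_basis)
  qed
qed

end
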